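(* Let $\phi=\{\phi_t,t\ge 0\}$ be a Feller Markov chain on $\mathsf{X}$, not necessarily $\varphi$-irreducible, and let $\{\mathcal{T}_z: z\in\mathbb{N}\}$ be an increasing sequence of stopping times with $\mathcal{T}_0=0$. Suppose that there are functions $V:\mathsf{X}\to(0,\infty)$, $\delta:\mathsf{X}\to[1,\infty)$, $f:\mathsf{X}\to[1,\infty)$, a compact set $C$, and a constant $b\in\mathbb{R}$ such that for every $z\ge 0$ $$\mathsf{E}[V(\phi_{\mathcal{T}_{z+1}})\mid\mathcal{F}_{\mathcal{T}_z}]\le V(\phi_{\mathcal{T}_z})-\delta(\phi_{\mathcal{T}_z})+b\,1_{\{\phi_{\mathcal{T}_z}\in C\}},$$ $$\mathsf{E}\Bigl[\sum_{k=\mathcal{T}_z}^{\mathcal{T}_{z+1}-1}f(\phi_k)\,\Big|\,\mathcal{F}_{\mathcal{T}_z}\Bigr]\le\delta(\phi_{\mathcal{T}_z}).$$ Then there exists at least one invariant probability measure. Moreover, there exists $c<\infty$ such that, under any invariant probability measure $\pi$, $$\mathsf{E}_\pi[f(\phi_t)]=\int_{\mathsf{X}}\pi(d\phi)f(\phi)\le c.$$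
   Context: $\mathsf{X}$ is a complete separable metric space that is locally compact, with Borel $\sigma$-field $\mathcal{B}(\mathsf{X})$; all functions are measurable. $\phi=\{\phi_t,t\ge0\}$ is a (time-homogeneous) Markov chain on $\mathsf{X}$ with transition probability $P$. The chain is (weak) Feller if $Pg(\phi):=\int P(\phi,dy)g(y)$ is continuous on $\mathsf{X}$ for every continuous bounded $g:\mathsf{X}\to\mathbb{R}$. A probability measure $\pi$ is invariant if $\int\pi(d\phi)P(\phi,A)=\pi(A)$ for all $A\in\mathcal{B}(\mathsf{X})$; $\mathsf{E}_\pi$ is expectation when $\phi_0\sim\pi$. $\mathcal{F}_{\mathcal{T}}$ is the $\sigma$-field of events up to the stopping time $\mathcal{T}$; "increasing" means $\mathcal{T}_{z+1}>\mathcal{T}_z$. The inequalities involving conditional expectations are understood almost surely, for the chain started from any initial condition. *)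

theory Defs
  imports "HOL-Probability.Probability"
begin

text \<open>
  A time-homogeneous Markov chain \<open>X\<close> with transition probability \<open>P\<close>, given as the usual family of
  laws: \<open>Pr \<mu>\<close> is the probability on the measurable space \<open>M\<close> under which \<open>X 0\<close> has law \<open>\<mu>\<close>, so that
  \<open>Pr (return borel x)\<close> is the law of the chain started from \<open>x\<close>. The filtration \<open>F\<close> is any one to
  which \<open>X\<close> is adapted and for which the Markov property holds; the filtration generated by \<open>X\<close>
  and the coordinate process on path space are instances.
\<close>

locale markov_chain = filtration "space M" F
  for M :: "'w measure" and F :: "nat \<Rightarrow> 'w measure" +
  fixes P :: "'a::topological_space \<Rightarrow> 'a measure"
    and X :: "nat \<Rightarrow> 'w \<Rightarrow> 'a"
    and Pr :: "'a measure \<Rightarrow> 'w measure"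
  assumes kernel: "P \<in> borel \<rightarrow>\<^sub>M prob_algebra borel"
    and subalgebra_F: "\<And>t. subalgebra M (F t)"
    and adapted: "\<And>t. X t \<in> F t \<rightarrow>\<^sub>M borel"
    and prob_Pr: "\<And>\<mu>. \<mu> \<in> space (prob_algebra borel) \<Longrightarrow> Pr \<mu> \<in> space (prob_algebra M)"
    and initial: "\<And>\<mu>. \<mu> \<in> space (prob_algebra borel) \<Longrightarrow> distr (Pr \<mu>) borel (X 0) = \<mu>"
    and markov: "\<And>\<mu> t B. \<mu> \<in> space (prob_algebra borel) \<Longrightarrow> B \<in> sets borel \<Longrightarrow>
      AE \<omega> in Pr \<mu>.
        real_cond_exp (Pr \<mu>) (F t) (\<lambda>\<omega>'. indicator B (X (Suc t) \<omega>')) \<omega> = measure (P (X t \<omega>)) B"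

definition feller :: "('a::topological_space \<Rightarrow> 'a measure) \<Rightarrow> bool" where
  "feller P \<longleftrightarrow>
    (\<forall>g :: 'a \<Rightarrow> real. continuous_on UNIV g \<longrightarrow> bounded (range g) \<longrightarrow>
      continuous_on UNIV (\<lambda>x. \<integral>y. g y \<partial>P x))"

definition invariant_prob :: "('a::topological_space \<Rightarrow> 'a measure) \<Rightarrow> 'a measure \<Rightarrow> bool" where
  "invariant_prob P \<pi> \<longleftrightarrow>
    \<pi> \<in> space (prob_algebra borel) \<and>
    (\<forall>A\<in>sets borel. (\<integral>\<^sup>+x. emeasure (P x) A \<partial>\<pi>) = emeasure \<pi> A)"

end

theory Submission
  imports Defs
begin

text \<open>
  Stopping the drift inequality at the first \<open>z\<close> with \<open>T z \<ge> N\<close>, and using that this forces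
  \<open>z \<le> N\<close>, removes the stopping times:
  the sum over \<open>k < N\<close> of \<open>E\<^sub>x f (X k)\<close> is at most \<open>V x + b\<^sup>+\<close> times the expected number of visits
  to \<open>C\<close> before time \<open>N\<close>.
  Dividing by \<open>N\<close> and integrating a truncation of \<open>f\<close> against an invariant \<open>\<pi>\<close> gives \<open>\<integral> f d\<pi> \<le> b\<^sup>+\<close>.
  As \<open>f \<ge> 1\<close>, the same bound keeps the averaged laws from losing all their mass on \<open>C\<close>, so they have
  a non-zero vague limit \<open>\<nu>\<close>. The Feller property gives \<open>\<nu> P \<le> \<nu>\<close> on open sets, hence on Borel
  sets; both sides have the same total mass, so \<open>\<nu>\<close> is invariant.
\<close>

subsection \<open>Stopped drift inequality\<close>

text \<open>Vague limits test only compactly supported functions, and \<open>P g\<close> need not be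
  one when \<open>g\<close> is; the Feller property can be used only through cutoffs, and these cost
  an equality.

  The drift is controlled only at random times. Strict growth of \<open>T\<close> does two jobs: the
  blocks between consecutive stopping times partition the time axis, so that costs per block add up
  to costs over all times; and distinct \<open>z\<close> give distinct times, so that visits to
  \<open>C\<close> at the stopping times are at most the visits of the chain itself. There are at
  most \<open>N\<close> of these before time \<open>N\<close>, which is why the final constant
  depends on \<open>b\<close> alone and not on the lengths of the blocks.

  The hypotheses concern deterministic starting points, whereas \<pi> is an initial law against
  which \<open>V\<close> may fail to be integrable. Hence the estimate is kept pointwise in the
  start and truncated before it is integrated.\<close>

context markov_chain
begin

section \<open>Marginal laws of the chain and its values at stopping times\<close>

lemma sets_Pr: "\<mu> \<in> space (prob_algebra borel) \<Longrightarrow> sets (Pr \<mu>) = sets M"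
  using prob_Pr by (simp add: space_prob_algebra)

lemma prob_space_Pr: "\<mu> \<in> space (prob_algebra borel) \<Longrightarrow> prob_space (Pr \<mu>)"
  using prob_Pr by (simp add: space_prob_algebra)

lemma measurable_X_Pr [measurable]:
  assumes "\<mu> \<in> space (prob_algebra borel)"
  shows "X t \<in> Pr \<mu> \<rightarrow>\<^sub>M borel"
  using measurable_from_subalg[OF subalgebra_F adapted] sets_Pr[OF assms]
  by (simp cong: measurable_cong_sets)

lemma law_in_prob_algebra:
  assumes "\<mu> \<in> space (prob_algebra borel)"
  shows "distr (Pr \<mu>) borel (X t) \<in> space (prob_algebra borel)"
  using prob_space.prob_space_distr[OF prob_space_Pr[OF assms] measurable_X_Pr[OF assms]]
  by (simp add: space_prob_algebra)

text \<open>Taking expectations in \<open>markov\<close> removes the conditioning, so the filtration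
  drops out: the marginal laws depend on \<open>P\<close> and the initial law alone.\<close>

lemma law_Suc:
  assumes \<mu>: "\<mu> \<in> space (prob_algebra borel)"
  shows "distr (Pr \<mu>) borel (X (Suc t)) = distr (Pr \<mu>) borel (X t) \<bind> P"
proof (rule measure_eqI)
  note [measurable] = measurable_X_Pr[OF \<mu>] measurable_prob_algebraD[OF kernel]
  show sets_eq: "sets (distr (Pr \<mu>) borel (X (Suc t))) = sets (distr (Pr \<mu>) borel (X t) \<bind> P)"
    by (subst sets_bind'[OF law_in_prob_algebra[OF \<mu>] kernel]) simp
  fix B assume "B \<in> sets (distr (Pr \<mu>) borel (X (Suc t)))"
  then have B[measurable]: "B \<in> sets borel" by simp
  interpret prob_space "Pr \<mu>" by (rule prob_space_Pr[OF \<mu>])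
  have sub: "subalgebra (Pr \<mu>) (F t)"
    using subalgebra_F sets_Pr[OF \<mu>] sets_eq_imp_space_eq[OF sets_Pr[OF \<mu>]]
    by (auto simp: subalgebra_def)
  interpret finite_measure_subalgebra "Pr \<mu>" "F t"
    by (standard, rule sub)
  let ?p = "\<lambda>\<omega>. measure (P (X t \<omega>)) B"
  have P_prob: "prob_space (P x)" for x
    using measurable_space[OF kernel, of x] by (simp add: space_prob_algebra)
  have int: "integrable (Pr \<mu>) (\<lambda>\<omega>. indicator B (X (Suc t) \<omega>) :: real)"
    by (rule integrable_const_bound[where B=1]) auto
  have "(\<integral>\<omega>. ?p \<omega> \<partial>Pr \<mu>) = (\<integral>\<omega>. indicator B (X (Suc t) \<omega>) \<partial>Pr \<mu>)"
    using integral_cong_AE[OF _ _ markov[OF \<mu> B, of t]] real_cond_exp_int(2)[OF int] by simp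
  also have "\<dots> = measure (distr (Pr \<mu>) borel (X (Suc t))) B"
    using integral_distr[of "X (Suc t)" "Pr \<mu>" borel "indicator B :: _ \<Rightarrow> real"] by simp
  finally have *: "(\<integral>\<omega>. ?p \<omega> \<partial>Pr \<mu>) = measure (distr (Pr \<mu>) borel (X (Suc t))) B" .
  interpret D: prob_space "distr (Pr \<mu>) borel (X (Suc t))"
    by (rule prob_space_distr) measurable
  have "emeasure (distr (Pr \<mu>) borel (X t) \<bind> P) B = (\<integral>\<^sup>+\<omega>. emeasure (P (X t \<omega>)) B \<partial>Pr \<mu>)"
    by (subst emeasure_bind[where N=borel]) (auto simp: nn_integral_distr)
  also have "\<dots> = (\<integral>\<^sup>+\<omega>. ennreal (?p \<omega>) \<partial>Pr \<mu>)"
    using P_prob by (simp add: finite_measure.emeasure_eq_measure prob_space_def)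
  also have "\<dots> = ennreal (\<integral>\<omega>. ?p \<omega> \<partial>Pr \<mu>)"
    using P_prob by (intro nn_integral_eq_integral integrable_const_bound[where B=1])
      (auto simp: prob_space.prob_le_1)
  finally show "emeasure (distr (Pr \<mu>) borel (X (Suc t))) B = emeasure (distr (Pr \<mu>) borel (X t) \<bind> P) B"
    unfolding * by (simp add: D.emeasure_eq_measure)
qed

text \<open>On \<open>T \<omega> \<le> t\<close> the event splits into the finitely many pieces with
  \<open>T \<omega> = s\<close>, \<open>s \<le> t\<close>, each already in \<open>F s\<close>. This
  makes the chain sampled at a stopping time a random variable.\<close>

lemma measurable_stopped_pre_sigma:
  assumes T: "stopping_time F T"
  shows "(\<lambda>\<omega>. X (T \<omega>) \<omega>) \<in> pre_sigma T \<rightarrow>\<^sub>M borel"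
proof (rule measurableI)
  fix B :: "'a set" assume B: "B \<in> sets borel"
  have "Measurable.pred (pre_sigma T) (\<lambda>\<omega>. X (T \<omega>) \<omega> \<in> B)"
  proof (rule pred_pre_sigmaI[OF T])
    fix t
    have "(\<lambda>\<omega>. X (T \<omega>) \<omega> \<in> B \<and> T \<omega> \<le> t) = (\<lambda>\<omega>. \<exists>s\<in>{..t}. T \<omega> = s \<and> X s \<omega> \<in> B)"
      by auto
    moreover have "Measurable.pred (F t) (\<lambda>\<omega>. T \<omega> = s \<and> X s \<omega> \<in> B)" if "s \<le> t" for s
    proof -
      have "Measurable.pred (F s) (\<lambda>\<omega>. T \<omega> = s \<and> X s \<omega> \<in> B)"
        using stopping_time_eq_const[OF T, of s] adapted[of s] B by measurable
      then show ?thesis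
        using sets_F_mono[OF that] by (auto simp: pred_def space_F)
    qed
    ultimately show "Measurable.pred (F t) (\<lambda>\<omega>. X (T \<omega>) \<omega> \<in> B \<and> T \<omega> \<le> t)"
      by (simp only:) (intro pred_intros_countable_bounded; simp)
  qed
  then show "(\<lambda>\<omega>. X (T \<omega>) \<omega>) -` B \<inter> space (pre_sigma T) \<in> sets (pre_sigma T)"
    by (simp add: pred_def vimage_def Int_def conj_commute)
qed auto

lemma subalgebra_pre_sigma:
  assumes T: "stopping_time F T" and \<mu>: "\<mu> \<in> space (prob_algebra borel)"
  shows "subalgebra (Pr \<mu>) (pre_sigma T)"
  unfolding subalgebra_def
proof
  show "space (pre_sigma T) = space (Pr \<mu>)"
    using sets_eq_imp_space_eq[OF sets_Pr[OF \<mu>]] by (simp add: space_pre_sigma)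
  show "sets (pre_sigma T) \<subseteq> sets (Pr \<mu>)"
  proof
    fix A assume A: "A \<in> sets (pre_sigma T)"
    have "A = (\<Union>t. {\<omega>\<in>A. T \<omega> \<le> t})" by auto
    also have "\<dots> \<in> sets M"
      using sets_pre_sigmaD[OF T A] subalgebra_F by (intro sets.countable_UN) (auto simp: subalgebra_def)
    finally show "A \<in> sets (Pr \<mu>)" using sets_Pr[OF \<mu>] by simp
  qed
qed


text \<open>A Foster-Lyapunov argument for the sampled chain, restricted to the indices with
  \<open>T z \<omega> < N\<close>. All expectations are taken in \<open>ennreal\<close>, so infinite
  values of the integrals of \<open>V\<close> and \<open>f\<close> are allowed throughout.\<close>

lemma stopped_sum_bound:
  fixes T :: "nat \<Rightarrow> 'w \<Rightarrow> nat" and V \<delta> f :: "'a \<Rightarrow> real" and b :: real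
  assumes stop: "\<And>z. stopping_time F (T z)"
    and T0: "\<And>\<omega>. \<omega> \<in> space M \<Longrightarrow> T 0 \<omega> = 0"
    and Tinc: "\<And>z \<omega>. \<omega> \<in> space M \<Longrightarrow> T z \<omega> < T (Suc z) \<omega>"
    and V[measurable]: "V \<in> borel_measurable borel" and Vpos: "\<And>x. V x > 0"
    and \<delta>[measurable]: "\<delta> \<in> borel_measurable borel" and \<delta>pos: "\<And>x. \<delta> x \<ge> 0"
    and f[measurable]: "f \<in> borel_measurable borel"
    and C[measurable]: "C \<in> sets borel"
    and \<mu>: "\<mu> \<in> space (prob_algebra borel)"
    and drift: "\<And>z. AE \<omega> in Pr \<mu>.
      enn2ereal (nn_cond_exp (Pr \<mu>) (pre_sigma (T z)) (\<lambda>\<omega>'. ennreal (V (X (T (Suc z) \<omega>') \<omega>'))) \<omega>)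
        \<le> ereal (V (X (T z \<omega>) \<omega>) - \<delta> (X (T z \<omega>) \<omega>) + b * indicator C (X (T z \<omega>) \<omega>))"
    and cost: "\<And>z. AE \<omega> in Pr \<mu>.
      nn_cond_exp (Pr \<mu>) (pre_sigma (T z)) (\<lambda>\<omega>'. \<Sum>k = T z \<omega>'..<T (Suc z) \<omega>'. ennreal (f (X k \<omega>'))) \<omega>
        \<le> ennreal (\<delta> (X (T z \<omega>) \<omega>))"
  shows "(\<Sum>k<N. \<integral>\<^sup>+\<omega>. ennreal (f (X k \<omega>)) \<partial>Pr \<mu>)
    \<le> (\<integral>\<^sup>+x. ennreal (V x) \<partial>\<mu>) + ennreal (max b 0) * (\<Sum>k<N. \<integral>\<^sup>+\<omega>. indicator C (X k \<omega>) \<partial>Pr \<mu>)"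
proof -
  define Q where "Q = Pr \<mu>"
  have space_Q: "space Q = space M"
    using sets_eq_imp_space_eq[OF sets_Pr[OF \<mu>]] by (simp add: Q_def)
  have XQ[measurable]: "X t \<in> Q \<rightarrow>\<^sub>M borel" for t
    unfolding Q_def by (rule measurable_X_Pr[OF \<mu>])
  interpret prob_space Q
    unfolding Q_def by (rule prob_space_Pr[OF \<mu>])
  define G where "G z = pre_sigma (T z)" for z
  have sub: "subalgebra Q (G z)" for z
    unfolding Q_def G_def by (rule subalgebra_pre_sigma[OF stop \<mu>])
  define W where "W z \<omega> = X (T z \<omega>) \<omega>" for z \<omega>
  have WG[measurable]: "W z \<in> G z \<rightarrow>\<^sub>M borel" for z
    unfolding G_def W_def by (rule measurable_stopped_pre_sigma[OF stop])
  have WQ[measurable]: "W z \<in> Q \<rightarrow>\<^sub>M borel" for z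
    by (rule measurable_from_subalg[OF sub WG])
  have TG[measurable]: "T z \<in> G z \<rightarrow>\<^sub>M count_space UNIV" for z
    using measurable_stopping_time_pre_sigma[OF stop, of z] unfolding G_def
    unfolding measurable_cong_sets[OF refl sets_borel_eq_count_space] .
  have TQ[measurable]: "T z \<in> Q \<rightarrow>\<^sub>M count_space UNIV" for z
    by (rule measurable_from_subalg[OF sub TG])
  \<comment> \<open>\<open>{T z < N}\<close> is known at time \<open>T z\<close> and empty for \<open>z = N\<close>, so the localised drift inequalities telescope.\<close>
  define E where "E z \<omega> = (if T z \<omega> < N then 1 else 0 :: ennreal)" for z \<omega>
  have EG[measurable]: "E z \<in> borel_measurable (G z)" for z
    unfolding E_def by measurable
  have EQ[measurable]: "E z \<in> borel_measurable Q" for z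
    by (rule measurable_from_subalg[OF sub EG])
  define S where "S z \<omega> = (\<Sum>k = T z \<omega>..<T (Suc z) \<omega>. ennreal (f (X k \<omega>)))" for z \<omega>
  have SQ[measurable]: "S z \<in> borel_measurable Q" for z
  proof -
    \<comment> \<open>The range of summation is random. As a series over all \<open>k\<close> with
      measurable cut-off terms the sum is visibly measurable.\<close>
    have "S z \<omega> = (\<Sum>k. if T z \<omega> \<le> k \<and> k < T (Suc z) \<omega> then ennreal (f (X k \<omega>)) else 0)" for \<omega>
      unfolding S_def
      by (subst suminf_finite[where N="{T z \<omega>..<T (Suc z) \<omega>}"]) (auto intro!: sum.cong)
    then have "S z = (\<lambda>\<omega>. \<Sum>k. if T z \<omega> \<le> k \<and> k < T (Suc z) \<omega> then ennreal (f (X k \<omega>)) else 0)"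
      by auto
    then show ?thesis by simp
  qed
  define B where "B = ennreal (max b 0)"
  define a where "a z = (\<integral>\<^sup>+\<omega>. E z \<omega> * ennreal (V (W z \<omega>)) \<partial>Q)" for z
  define d where "d z = (\<integral>\<^sup>+\<omega>. E z \<omega> * ennreal (\<delta> (W z \<omega>)) \<partial>Q)" for z
  define c where "c z = (\<integral>\<^sup>+\<omega>. E z \<omega> * indicator C (W z \<omega>) \<partial>Q)" for z
  have step: "a (Suc z) + d z \<le> a z + B * c z" for z
  proof -
    interpret finite_measure_subalgebra Q "G z"
      by standard (rule sub)
    let ?n = "nn_cond_exp Q (G z) (\<lambda>\<omega>. ennreal (V (W (Suc z) \<omega>)))"
    \<comment> \<open>The right side of the drift bound is a real number, so the conditional
      expectation is almost surely finite. Moving \<delta> to the left and enlarging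
      \<open>b\<close> to \<open>max b 0\<close> leaves only nonnegative terms, and the inequality
      can be read in \<open>ennreal\<close>.\<close>
    have AE: "AE \<omega> in Q. ?n \<omega> + ennreal (\<delta> (W z \<omega>)) \<le> ennreal (V (W z \<omega>)) + B * indicator C (W z \<omega>)"
      using drift[of z] unfolding Q_def[symmetric] G_def[symmetric] W_def[symmetric]
    proof eventually_elim
      case (elim \<omega>)
      let ?r = "V (W z \<omega>) - \<delta> (W z \<omega>) + b * indicator C (W z \<omega>)"
      obtain r where r: "?n \<omega> = ennreal r" "0 \<le> r"
        using elim by (cases "?n \<omega>") auto
      with elim have "r \<le> ?r" by (simp add: enn2ereal_ennreal)
      moreover have "b * indicator C (W z \<omega>) \<le> max b 0 * indicator C (W z \<omega>)"
        by (auto simp: indicator_def)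
      ultimately have "r + \<delta> (W z \<omega>) \<le> V (W z \<omega>) + max b 0 * indicator C (W z \<omega>)" by linarith
      then have "ennreal (r + \<delta> (W z \<omega>)) \<le> ennreal (V (W z \<omega>) + max b 0 * indicator C (W z \<omega>))"
        by (rule ennreal_leI)
      then show ?case
        using r(2) \<delta>pos[of "W z \<omega>"] less_imp_le[OF Vpos[of "W z \<omega>"]]
        by (auto simp: r(1) B_def ennreal_plus indicator_def split: if_splits)
    qed
    \<comment> \<open>\<open>E (Suc z)\<close> is in general not \<open>G z\<close>-measurable. It
      is enlarged to \<open>E z\<close>, which is, and which can therefore be pulled through the
      conditional expectation.\<close>
    have "a (Suc z) \<le> (\<integral>\<^sup>+\<omega>. E z \<omega> * ennreal (V (W (Suc z) \<omega>)) \<partial>Q)"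
      unfolding a_def
    proof (rule nn_integral_mono)
      fix \<omega> assume "\<omega> \<in> space Q"
      then have "E (Suc z) \<omega> \<le> E z \<omega>"
        using Tinc[of \<omega> z] by (auto simp: E_def space_Q)
      then show "E (Suc z) \<omega> * ennreal (V (W (Suc z) \<omega>)) \<le> E z \<omega> * ennreal (V (W (Suc z) \<omega>))"
        by (intro mult_right_mono) auto
    qed
    also have "\<dots> = (\<integral>\<^sup>+\<omega>. E z \<omega> * ?n \<omega> \<partial>Q)"
      by (rule nn_cond_exp_intg[symmetric]) measurable
    finally have "a (Suc z) + d z \<le> (\<integral>\<^sup>+\<omega>. E z \<omega> * ?n \<omega> \<partial>Q) + d z"
      by (rule add_right_mono)
    also have "\<dots> = (\<integral>\<^sup>+\<omega>. E z \<omega> * (?n \<omega> + ennreal (\<delta> (W z \<omega>))) \<partial>Q)"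
      by (simp add: d_def nn_integral_add distrib_left)
    also have "\<dots> \<le> (\<integral>\<^sup>+\<omega>. E z \<omega> * (ennreal (V (W z \<omega>)) + B * indicator C (W z \<omega>)) \<partial>Q)"
      using AE by (intro nn_integral_mono_AE) (auto elim!: eventually_mono intro: mult_left_mono)
    also have "\<dots> = a z + B * c z"
      by (simp add: a_def c_def nn_integral_add distrib_left mult.left_commute nn_integral_cmult)
    finally show ?thesis .
  qed
  have "a n + (\<Sum>z<n. d z) \<le> a 0 + B * (\<Sum>z<n. c z)" for n
  proof (induction n)
    case (Suc n)
    have "a (Suc n) + (\<Sum>z<Suc n. d z) = (a (Suc n) + d n) + (\<Sum>z<n. d z)"
      by (simp add: ac_simps)
    also have "\<dots> \<le> (a n + B * c n) + (\<Sum>z<n. d z)"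
      by (intro add_right_mono step)
    also have "\<dots> \<le> (a 0 + B * (\<Sum>z<n. c z)) + B * c n"
      using Suc.IH by (simp add: add.commute add.left_commute add_left_mono)
    finally show ?case by (simp add: distrib_left ac_simps)
  qed simp
  from this[of N] have d_le: "(\<Sum>z<N. d z) \<le> a 0 + B * (\<Sum>z<N. c z)"
    by (rule order_trans[rotated]) simp
  have S_le: "(\<integral>\<^sup>+\<omega>. E z \<omega> * S z \<omega> \<partial>Q) \<le> d z" for z
  proof -
    interpret finite_measure_subalgebra Q "G z"
      by standard (rule sub)
    have "(\<integral>\<^sup>+\<omega>. E z \<omega> * S z \<omega> \<partial>Q) = (\<integral>\<^sup>+\<omega>. E z \<omega> * nn_cond_exp Q (G z) (S z) \<omega> \<partial>Q)"
      by (rule nn_cond_exp_intg[symmetric]) measurable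
    also have "\<dots> \<le> d z"
      using cost[of z] unfolding Q_def[symmetric] G_def[symmetric] W_def[symmetric] S_def[symmetric] d_def
      by (intro nn_integral_mono_AE) (auto elim!: eventually_mono intro: mult_left_mono)
    finally show ?thesis .
  qed
  have T_mono: "strict_mono (\<lambda>z. T z \<omega>)" if "\<omega> \<in> space Q" for \<omega>
    using Tinc that by (auto simp: strict_mono_Suc_iff space_Q)
  \<comment> \<open>A time \<open>k < N\<close> lies in the block of the greatest \<open>z\<close>
    with \<open>T z \<omega> \<le> k\<close>; since \<open>z \<le> T z \<omega>\<close>, this
    \<open>z\<close> exists and is below \<open>N\<close>. The last block may run past
    \<open>N\<close>, but its extra terms only enlarge the right side.\<close>
  have cover: "(\<Sum>k<N. ennreal (f (X k \<omega>))) \<le> (\<Sum>z<N. E z \<omega> * S z \<omega>)" if \<omega>: "\<omega> \<in> space Q" for \<omega>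
  proof -
    note mono = T_mono[OF \<omega>]
    have ex: "\<exists>z<N. T z \<omega> < N \<and> k \<in> {T z \<omega>..<T (Suc z) \<omega>}" if "k < N" for k
    proof -
      define z where "z = (GREATEST z. T z \<omega> \<le> k)"
      have bound: "\<And>y. T y \<omega> \<le> k \<Longrightarrow> y \<le> k"
        using seq_suble[OF mono] by (meson order_trans)
      have 0: "T 0 \<omega> \<le> k" using T0 \<omega> by (simp add: space_Q)
      have 1: "T z \<omega> \<le> k"
        unfolding z_def by (rule GreatestI_nat[where P="\<lambda>z. T z \<omega> \<le> k" and k=0 and b=k]) (use 0 bound in auto)
      have "\<not> T (Suc z) \<omega> \<le> k"
        using Greatest_le_nat[of "\<lambda>z. T z \<omega> \<le> k" "Suc z" k] bound by (auto simp: z_def[symmetric])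
      then show ?thesis
        using 1 that bound[OF 1] by (intro exI[of _ z]) auto
    qed
    have "(\<Sum>k<N. ennreal (f (X k \<omega>))) \<le> (\<Sum>k\<in>(\<Union>z\<in>{z. z < N \<and> T z \<omega> < N}. {T z \<omega>..<T (Suc z) \<omega>}). ennreal (f (X k \<omega>)))"
      using ex by (intro sum_mono2) auto
    also have "\<dots> = (\<Sum>z\<in>{z. z < N \<and> T z \<omega> < N}. \<Sum>k\<in>{T z \<omega>..<T (Suc z) \<omega>}. ennreal (f (X k \<omega>)))"
    proof (rule sum.UNION_disjoint)
      show "\<forall>i\<in>{z. z < N \<and> T z \<omega> < N}. \<forall>j\<in>{z. z < N \<and> T z \<omega> < N}. i \<noteq> j \<longrightarrow>
          {T i \<omega>..<T (Suc i) \<omega>} \<inter> {T j \<omega>..<T (Suc j) \<omega>} = {}"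
      proof (intro ballI impI)
        fix i j :: nat assume "i \<noteq> j"
        then consider "Suc i \<le> j" | "Suc j \<le> i" by linarith
        then show "{T i \<omega>..<T (Suc i) \<omega>} \<inter> {T j \<omega>..<T (Suc j) \<omega>} = {}"
        proof cases
          case 1
          then have "T (Suc i) \<omega> \<le> T j \<omega>" using strict_mono_less_eq[OF mono] by simp
          then show ?thesis by auto
        next
          case 2
          then have "T (Suc j) \<omega> \<le> T i \<omega>" using strict_mono_less_eq[OF mono] by simp
          then show ?thesis by auto
        qed
      qed
    qed auto
    also have "\<dots> = (\<Sum>z<N. E z \<omega> * S z \<omega>)"
      unfolding E_def S_def by (intro sum.mono_neutral_cong_left) auto
    finally show ?thesis .
  qed
  have visits: "(\<Sum>z<N. E z \<omega> * indicator C (W z \<omega>)) \<le> (\<Sum>k<N. indicator C (X k \<omega>) :: ennreal)"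
    if \<omega>: "\<omega> \<in> space Q" for \<omega>
  proof -
    have "(\<Sum>z<N. E z \<omega> * indicator C (W z \<omega>)) = (\<Sum>z\<in>{z. z < N \<and> T z \<omega> < N}. indicator C (W z \<omega>))"
      unfolding E_def by (intro sum.mono_neutral_cong_right) auto
    also have "\<dots> = (\<Sum>k\<in>(\<lambda>z. T z \<omega>) ` {z. z < N \<and> T z \<omega> < N}. indicator C (X k \<omega>))"
      unfolding W_def
      by (subst sum.reindex) (auto intro: inj_on_subset[OF strict_mono_imp_inj_on[OF T_mono[OF \<omega>]]])
    also have "\<dots> \<le> (\<Sum>k<N. indicator C (X k \<omega>))"
      by (intro sum_mono2) auto
    finally show ?thesis .
  qed
  have "(\<Sum>k<N. \<integral>\<^sup>+\<omega>. ennreal (f (X k \<omega>)) \<partial>Q) = (\<integral>\<^sup>+\<omega>. (\<Sum>k<N. ennreal (f (X k \<omega>))) \<partial>Q)"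
    by (subst nn_integral_sum) auto
  also have "\<dots> \<le> (\<integral>\<^sup>+\<omega>. (\<Sum>z<N. E z \<omega> * S z \<omega>) \<partial>Q)"
    by (intro nn_integral_mono cover)
  also have "\<dots> = (\<Sum>z<N. \<integral>\<^sup>+\<omega>. E z \<omega> * S z \<omega> \<partial>Q)"
    by (subst nn_integral_sum) auto
  also have "\<dots> \<le> (\<Sum>z<N. d z)"
    by (intro sum_mono S_le)
  also note d_le
  also have "a 0 \<le> (\<integral>\<^sup>+x. ennreal (V x) \<partial>\<mu>)"
  proof -
    have "a 0 \<le> (\<integral>\<^sup>+\<omega>. ennreal (V (X 0 \<omega>)) \<partial>Q)"
      unfolding a_def by (intro nn_integral_mono) (auto simp: E_def W_def T0 space_Q)
    also have "\<dots> = (\<integral>\<^sup>+x. ennreal (V x) \<partial>distr Q borel (X 0))"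
      by (simp add: nn_integral_distr)
    finally show ?thesis unfolding Q_def initial[OF \<mu>] .
  qed
  also have "(\<Sum>z<N. c z) = (\<integral>\<^sup>+\<omega>. (\<Sum>z<N. E z \<omega> * indicator C (W z \<omega>)) \<partial>Q)"
    unfolding c_def by (subst nn_integral_sum) auto
  also have "\<dots> \<le> (\<integral>\<^sup>+\<omega>. (\<Sum>k<N. indicator C (X k \<omega>)) \<partial>Q)"
    by (intro nn_integral_mono visits)
  also have "\<dots> = (\<Sum>k<N. \<integral>\<^sup>+\<omega>. indicator C (X k \<omega>) \<partial>Q)"
    by (subst nn_integral_sum) auto
  finally show ?thesis
    by (simp add: Q_def B_def add_right_mono mult_left_mono)
qed

end

subsection \<open>Integrals against invariant probabilities\<close>

text \<open>The \<open>k\<close>-step transition probability. The new step is appended at the end,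
  which is the recursion that \<open>law_Suc\<close> gives for the laws of the chain.\<close>

primrec kernel_power :: "('a::topological_space \<Rightarrow> 'a measure) \<Rightarrow> nat \<Rightarrow> 'a \<Rightarrow> 'a measure" where
  "kernel_power P 0 x = return borel x"
| "kernel_power P (Suc k) x = kernel_power P k x \<bind> P"

lemma measurable_kernel_power [measurable (raw)]:
  assumes P: "P \<in> borel \<rightarrow>\<^sub>M prob_algebra borel"
  shows "kernel_power P k \<in> borel \<rightarrow>\<^sub>M prob_algebra borel"
proof (induction k)
  case 0
  show ?case by (simp add: measurable_return_prob_space cong: measurable_cong)
next
  case (Suc k)
  then show ?case
    using measurable_bind_prob_space[OF Suc P] by (simp cong: measurable_cong)
qed

lemma invariant_prob_bind:
  assumes P: "P \<in> borel \<rightarrow>\<^sub>M prob_algebra borel" and \<pi>: "invariant_prob P \<pi>"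
  shows "\<pi> \<bind> P = \<pi>"
proof (rule measure_eqI)
  have prob: "\<pi> \<in> space (prob_algebra borel)" using \<pi> by (simp add: invariant_prob_def)
  then have sets: "sets \<pi> = sets borel" by (simp add: space_prob_algebra)
  show "sets (\<pi> \<bind> P) = sets \<pi>"
    by (simp add: sets_bind'[OF prob P] sets)
  fix A assume "A \<in> sets (\<pi> \<bind> P)"
  then have A: "A \<in> sets borel" by (simp add: sets_bind'[OF prob P])
  have "P \<in> \<pi> \<rightarrow>\<^sub>M subprob_algebra borel"
    using measurable_prob_algebraD[OF P] by (simp add: measurable_cong_sets[OF sets refl])
  then show "emeasure (\<pi> \<bind> P) A = emeasure \<pi> A"
    using \<pi> A sets_eq_imp_space_eq[OF sets] by (subst emeasure_bind[where N=borel]) (auto simp: invariant_prob_def)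
qed

lemma invariant_prob_bind_power:
  assumes P: "P \<in> borel \<rightarrow>\<^sub>M prob_algebra borel" and \<pi>: "invariant_prob P \<pi>"
  shows "\<pi> \<bind> kernel_power P k = \<pi>"
proof (induction k)
  have sets: "sets \<pi> = sets borel" using \<pi> by (simp add: invariant_prob_def space_prob_algebra)
  {
    case 0
    have "kernel_power P 0 = return borel" by auto
    then show ?case using bind_return''[OF sets] by simp
  next
    case (Suc k)
    have "kernel_power P k \<in> \<pi> \<rightarrow>\<^sub>M subprob_algebra borel"
      using measurable_prob_algebraD[OF measurable_kernel_power[OF P]]
      by (simp add: measurable_cong_sets[OF sets refl])
    from bind_assoc[OF this measurable_prob_algebraD[OF P]] Suc invariant_prob_bind[OF P \<pi>]
    show ?case by (simp add: comp_def)
  }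
qed

text \<open>By invariance the integral of \<open>f\<close> equals the average over
  \<open>k < N\<close> of its \<open>k\<close>-step expectations. \<open>V\<close> need not be
  \<pi>-integrable, so \<open>f\<close> is capped at \<open>m\<close>: the averages are then at most
  \<open>m\<close> as well as \<open>V x / N + B\<close>, hence at most
  \<open>min m (V x / N) + B\<close>. Dominated convergence with the constant \<open>m\<close>
  removes \<open>V\<close> as \<open>N\<close> grows; then \<open>m\<close> tends to
  infinity.\<close>

lemma invariant_prob_nn_integral_le:
  fixes f :: "'a::topological_space \<Rightarrow> ennreal" and V :: "'a \<Rightarrow> real" and B :: real
  assumes P: "P \<in> borel \<rightarrow>\<^sub>M prob_algebra borel" and \<pi>: "invariant_prob P \<pi>"
    and f[measurable]: "f \<in> borel_measurable borel"
    and V[measurable]: "V \<in> borel_measurable borel" and B: "0 \<le> B"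
    and Vpos: "\<And>x. 0 \<le> V x"
    and bound: "\<And>x N. (\<Sum>k<N. \<integral>\<^sup>+y. f y \<partial>kernel_power P k x) \<le> ennreal (V x) + ennreal B * of_nat N"
  shows "(\<integral>\<^sup>+x. f x \<partial>\<pi>) \<le> ennreal B"
proof -
  have prob: "prob_space \<pi>" and sets[measurable_cong]: "sets \<pi> = sets borel"
    using \<pi> by (simp_all add: invariant_prob_def space_prob_algebra)
  interpret prob_space \<pi> by (rule prob)
  note [measurable] = measurable_prob_algebraD[OF measurable_kernel_power[OF P]]
  have pw: "kernel_power P k x \<in> space (prob_algebra borel)" for k x
    using measurable_space[OF measurable_kernel_power[OF P], of x k] by simp
  have "(\<integral>\<^sup>+x. min (f x) (of_nat m) \<partial>\<pi>) \<le> ennreal B" (is "?A \<le> _") for m :: nat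
  proof -
    let ?t = "\<lambda>N. \<integral>\<^sup>+x. min (of_nat m) (ennreal (V x / real N)) \<partial>\<pi>"
    have "?t \<longlonglongrightarrow> (\<integral>\<^sup>+x. 0 \<partial>\<pi>)"
    proof (rule nn_integral_dominated_convergence[where w="\<lambda>_. of_nat m"])
      show "AE x in \<pi>. (\<lambda>N. min (of_nat m) (ennreal (V x / real N))) \<longlonglongrightarrow> 0"
      proof (rule AE_I2)
        fix x
        have "(\<lambda>N. V x / real N) \<longlonglongrightarrow> 0" by (rule lim_const_over_n)
        then have "(\<lambda>N. ennreal (V x / real N)) \<longlonglongrightarrow> 0"
          using tendsto_ennrealI[of _ 0] by simp
        from tendsto_min[OF tendsto_const this, of "of_nat m"]
        show "(\<lambda>N. min (of_nat m) (ennreal (V x / real N))) \<longlonglongrightarrow> 0" by simp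
      qed
      show "(\<integral>\<^sup>+x. of_nat m \<partial>\<pi>) < \<infinity>"
        by (simp add: emeasure_space_1 ennreal_of_nat_eq_real_of_nat)
    qed auto
    then have lim: "(\<lambda>N. ?t N + ennreal B) \<longlonglongrightarrow> 0 + ennreal B"
      by (intro tendsto_add) auto
    have "?A \<le> ?t N + ennreal B" if N: "N > 0" for N
    proof -
      have ae: "(\<Sum>k<N. \<integral>\<^sup>+y. min (f y) (of_nat m) \<partial>kernel_power P k x)
          \<le> of_nat N * (min (of_nat m) (ennreal (V x / real N)) + ennreal B)" (is "?L \<le> _") for x
      proof -
        have "(\<integral>\<^sup>+y. min (f y) (of_nat m) \<partial>kernel_power P k x) \<le> of_nat m" for k
        proof -
          interpret K: prob_space "kernel_power P k x" using pw by (simp add: space_prob_algebra)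
          have "(\<integral>\<^sup>+y. min (f y) (of_nat m) \<partial>kernel_power P k x) \<le> (\<integral>\<^sup>+y. of_nat m \<partial>kernel_power P k x)"
            by (intro nn_integral_mono) auto
          then show ?thesis by (simp add: K.emeasure_space_1)
        qed
        then have "?L \<le> (\<Sum>k<N. of_nat m)" by (intro sum_mono)
        then have 1: "?L \<le> of_nat N * of_nat m" by simp
        have "?L \<le> (\<Sum>k<N. \<integral>\<^sup>+y. f y \<partial>kernel_power P k x)"
          by (intro sum_mono nn_integral_mono) auto
        also note bound
        also have "ennreal (V x) = of_nat N * ennreal (V x / real N)"
          using N Vpos[of x] by (simp add: ennreal_of_nat_eq_real_of_nat flip: ennreal_mult)
        finally have 2: "?L \<le> of_nat N * (ennreal (V x / real N) + ennreal B)"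
          by (simp add: distrib_left mult.commute)
        show ?thesis
        proof (cases "of_nat m \<le> ennreal (V x / real N)")
          case True
          have "?L \<le> of_nat N * (of_nat m + ennreal B)"
            using 1 by (rule order_trans) (intro mult_left_mono; simp)
          with True show ?thesis by (simp add: min_absorb1)
        qed (use 2 in \<open>simp add: min_absorb2\<close>)
      qed
      have "of_nat N * ?A = (\<Sum>k<N. ?A)" by simp
      also have "\<dots> = (\<Sum>k<N. \<integral>\<^sup>+x. \<integral>\<^sup>+y. min (f y) (of_nat m) \<partial>kernel_power P k x \<partial>\<pi>)"
      proof (rule sum.cong[OF refl])
        fix k
        have "?A = (\<integral>\<^sup>+x. min (f x) (of_nat m) \<partial>(\<pi> \<bind> kernel_power P k))"
          by (simp add: invariant_prob_bind_power[OF P \<pi>])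
        also have "\<dots> = (\<integral>\<^sup>+x. \<integral>\<^sup>+y. min (f y) (of_nat m) \<partial>kernel_power P k x \<partial>\<pi>)"
          by (rule nn_integral_bind[where B=borel]) auto
        finally show "?A = \<dots>" .
      qed
      also have "\<dots> = (\<integral>\<^sup>+x. (\<Sum>k<N. \<integral>\<^sup>+y. min (f y) (of_nat m) \<partial>kernel_power P k x) \<partial>\<pi>)"
        by (subst nn_integral_sum) auto
      also have "\<dots> \<le> (\<integral>\<^sup>+x. of_nat N * (min (of_nat m) (ennreal (V x / real N)) + ennreal B) \<partial>\<pi>)"
        by (intro nn_integral_mono ae)
      also have "\<dots> = of_nat N * (?t N + ennreal B)"
        by (simp add: nn_integral_cmult nn_integral_add emeasure_space_1)
      finally show ?thesis
        using N by (subst (asm) ennreal_mult_le_mult_iff) auto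
    qed
    then show "?A \<le> ennreal B"
      by (intro LIMSEQ_le_const[OF lim[unfolded add_0]] exI[of _ 1]) auto
  qed
  moreover have "(\<integral>\<^sup>+x. f x \<partial>\<pi>) = (SUP m::nat. \<integral>\<^sup>+x. min (f x) (of_nat m) \<partial>\<pi>)"
  proof -
    have "(SUP m::nat. min (f x) (of_nat m)) = f x" for x
      by (simp add: inf_min[symmetric] inf_SUP[symmetric] ennreal_SUP_of_nat_eq_top)
    then have "(\<integral>\<^sup>+x. f x \<partial>\<pi>) = (\<integral>\<^sup>+x. (SUP m::nat. min (f x) (of_nat m)) \<partial>\<pi>)" by simp
    also have "\<dots> = (SUP m::nat. \<integral>\<^sup>+x. min (f x) (of_nat m) \<partial>\<pi>)"
      by (rule nn_integral_monotone_convergence_SUP)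
        (auto simp: incseq_def le_fun_def intro: min.coboundedI2)
    finally show ?thesis .
  qed
  ultimately show ?thesis by (auto intro: SUP_least)
qed

context markov_chain
begin

text \<open>\<open>Pr\<close> carries no measurability in its argument. Passing to kernel powers,
  which are measurable in \<open>x\<close>, turns estimates for each starting point into functions
  that can be integrated against \<pi>.\<close>

lemma law_return: "distr (Pr (return borel x)) borel (X k) = kernel_power P k x"
proof -
  have "return borel x \<in> space (prob_algebra borel)"
    by (simp add: space_prob_algebra prob_space_return)
  then show ?thesis
    by (induction k) (simp_all add: initial law_Suc)
qed

lemma law_invariant:
  assumes "invariant_prob P \<pi>"
  shows "distr (Pr \<pi>) borel (X k) = \<pi>"
proof -
  have "\<pi> \<in> space (prob_algebra borel)" using assms by (simp add: invariant_prob_def)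
  then show ?thesis
    by (induction k) (simp_all add: initial law_Suc invariant_prob_bind[OF kernel assms])
qed

end

subsection \<open>Vague sequential compactness\<close>

definition compactly_supported :: "('a::topological_space \<Rightarrow> real) \<Rightarrow> bool" where
  "compactly_supported g \<longleftrightarrow> continuous_on UNIV g \<and> (\<exists>K. compact K \<and> (\<forall>x. x \<notin> K \<longrightarrow> g x = 0))"

lemma compactly_supported_bounded:
  assumes "compactly_supported g"
  obtains B where "0 \<le> B" "\<And>x. \<bar>g x\<bar> \<le> B"
proof -
  obtain K where g: "continuous_on UNIV g" and K: "compact K" "\<And>x. x \<notin> K \<Longrightarrow> g x = 0"
    using assms by (auto simp: compactly_supported_def)
  have "compact (g ` K)"
    by (rule compact_continuous_image[OF continuous_on_subset[OF g] K(1)]) simp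
  then obtain B where B: "\<And>x. x \<in> K \<Longrightarrow> \<bar>g x\<bar> \<le> B"
    using compact_imp_bounded[of "g ` K"] by (auto simp: bounded_iff)
  show ?thesis
  proof (rule that[of "max B 0"])
    show "\<bar>g x\<bar> \<le> max B 0" for x using B[of x] K(2)[of x] by (cases "x \<in> K") auto
  qed simp
qed

lemma compactly_supported_measurable:
  "compactly_supported g \<Longrightarrow> g \<in> borel_measurable borel"
  by (auto simp: compactly_supported_def intro: borel_measurable_continuous_onI)

text \<open>Local compactness lets a countable basis be thinned to relatively compact sets. The
  distance to the complement is then a test function that is positive exactly on the basis set, so
  countably many test functions determine the topology.\<close>

lemma exists_bump_basis:
  assumes lc: "locally_compact_space (euclidean :: 'a::polish_space topology)"
  obtains U :: "nat \<Rightarrow> 'a::polish_space set" and b :: "nat \<Rightarrow> 'a::polish_space \<Rightarrow> real"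
  where "\<And>j. open (U j)" "\<And>j. compactly_supported (b j)" "\<And>j x. 0 \<le> b j x"
    "\<And>j x. b j x \<noteq> 0 \<longleftrightarrow> x \<in> U j"
    "\<And>W x. open W \<Longrightarrow> x \<in> W \<Longrightarrow> \<exists>j. x \<in> U j \<and> U j \<subseteq> W"
proof -
  obtain \<B> :: "'a set set" where \<B>: "countable \<B>" "topological_basis \<B>"
    using ex_countable_basis by blast
  define \<C> where "\<C> = {W\<in>\<B>. \<exists>K. compact K \<and> W \<subseteq> K}"
  have base: "\<exists>V\<in>\<C>. x \<in> V \<and> V \<subseteq> W" if W: "open W" "x \<in> W" for W x
  proof -
    obtain O' K where "open O'" "compact K" "x \<in> O'" "O' \<subseteq> K"
      using lc unfolding locally_compact_space_def by (simp; metis)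
    moreover obtain V where "V \<in> \<B>" "x \<in> V" "V \<subseteq> W \<inter> O'"
      using topological_basisE[OF \<B>(2), of "W \<inter> O'" x] W calculation by auto
    ultimately show ?thesis unfolding \<C>_def by blast
  qed
  have "countable \<C>" using \<B>(1) by (auto simp: \<C>_def)
  moreover have "\<C> \<noteq> {}" using base[of UNIV] by auto
  ultimately have range: "range (from_nat_into \<C>) = \<C>" by (simp add: range_from_nat_into)
  define U where "U = from_nat_into \<C>"
  \<comment> \<open>\<open>infdist x {}\<close> is \<open>0\<close>, so the whole space needs a
    value of its own. If it belongs to the basis it is compact, and the constant \<open>1\<close> is
    an admissible bump.\<close>
  define b where "b j x = (if U j = UNIV then 1 else infdist x (- U j))" for j x
  have U_in: "U j \<in> \<C>" for j using range by (auto simp: U_def)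
  have open_U: "open (U j)" for j
    using U_in[of j] \<B>(2) by (auto simp: \<C>_def topological_basis_open)
  have b_pos: "b j x \<noteq> 0 \<longleftrightarrow> x \<in> U j" for j x
  proof (cases "U j = UNIV")
    case False
    then show ?thesis
      using in_closed_iff_infdist_zero[of "- U j" x] open_U[of j] by (auto simp: b_def closed_def)
  qed (simp add: b_def)
  show ?thesis
  proof (rule that[of U b])
    show "compactly_supported (b j)" for j
    proof -
      have "continuous_on UNIV (b j)"
        by (cases "U j = UNIV") (auto simp: b_def[abs_def] intro!: continuous_intros)
      moreover obtain K where "compact K" "U j \<subseteq> K" using U_in[of j] by (auto simp: \<C>_def)
      ultimately show ?thesis using b_pos[of j] by (fastforce simp: compactly_supported_def)
    qed
    fix W :: "'a set" and x assume "open W" "x \<in> W"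
    then obtain V where V: "V \<in> \<C>" "x \<in> V" "V \<subseteq> W" using base by blast
    then have "V \<in> range (from_nat_into \<C>)" using range by simp
    then obtain j where "V = U j" unfolding U_def by blast
    with V show "\<exists>j. x \<in> U j \<and> U j \<subseteq> W" by auto
  next
    show "open (U j)" "0 \<le> b j x" "b j x \<noteq> 0 \<longleftrightarrow> x \<in> U j" for j x
      using open_U b_pos by (simp_all add: b_def infdist_nonneg)
  qed
qed

text \<open>
  Points are coded by their membership sequences in a countable basis. Relative to this code every
  compactly supported continuous function is uniformly continuous, so it extends to the closure of
  the (totally disconnected) set of codes and Helly's selection theorem on the real line applies.
\<close>

definition ternary :: "(nat \<Rightarrow> bool) \<Rightarrow> real" where
  "ternary a = (\<Sum>i. of_bool (a i) * (1/3) ^ i)"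

lemma summable_ternary: "summable (\<lambda>i. of_bool (a i) * (1/3 :: real) ^ i)"
  by (rule summable_comparison_test'[where g="\<lambda>i. (1/3) ^ i"]) (auto intro: summable_geometric)

section \<open>Separation properties of the ternary code\<close>

lemma ternary_bounds: "0 \<le> ternary a" "ternary a \<le> 3/2"
proof -
  show "0 \<le> ternary a"
    unfolding ternary_def by (rule suminf_nonneg[OF summable_ternary]) auto
  have "ternary a \<le> (\<Sum>i. (1/3) ^ i)"
    unfolding ternary_def by (rule suminf_le[OF _ summable_ternary]) (auto intro: summable_geometric)
  then show "ternary a \<le> 3/2" by (simp add: suminf_geometric)
qed

text \<open>In base three the weights after position \<open>n\<close> add up to half the weight at
  \<open>n\<close>, so later digits cannot cancel the first disagreement. In base two they could,
  since two digit sequences may share a value.\<close>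

lemma ternary_first_difference:
  assumes eq: "\<And>i. i < n \<Longrightarrow> a i = b i" and neq: "a n \<noteq> b n"
  shows "(1/3) ^ n / 2 \<le> \<bar>ternary a - ternary b\<bar>"
proof -
  let ?d = "\<lambda>i. (of_bool (a i) - of_bool (b i)) * (1/3 :: real) ^ i"
  have summ: "summable ?d"
    using summable_diff[OF summable_ternary[of a] summable_ternary[of b]] by (simp add: left_diff_distrib)
  have "ternary a - ternary b = (\<Sum>i. ?d i)"
    unfolding ternary_def
    by (subst suminf_diff[OF summable_ternary summable_ternary]) (simp add: left_diff_distrib)
  also have "\<dots> = (\<Sum>i. ?d (i + Suc n)) + (\<Sum>i<Suc n. ?d i)"
    by (rule suminf_split_initial_segment[OF summ])
  also have "(\<Sum>i<Suc n. ?d i) = ?d n"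
    using eq by simp
  finally have split: "ternary a - ternary b = (\<Sum>i. ?d (i + Suc n)) + ?d n" .
  have "(\<lambda>i. (1/3 :: real) ^ i) sums (3/2)"
    using geometric_sums[of "1/3 :: real"] by simp
  from sums_mult[OF this, of "(1/3) ^ Suc n"]
  have tail: "(\<lambda>i. (1/3 :: real) ^ (i + Suc n)) sums ((1/3) ^ n / 2)"
    by (simp add: power_add mult_ac)
  have "norm (?d i) \<le> (1/3) ^ i" for i
    by (cases "a i"; cases "b i") (simp_all del: power_one_over)
  then have "norm (\<Sum>i. ?d (i + Suc n)) \<le> (\<Sum>i. (1/3 :: real) ^ (i + Suc n))"
    by (intro norm_suminf_le[OF _ sums_summable[OF tail]])
  then have "\<bar>\<Sum>i. ?d (i + Suc n)\<bar> \<le> (1/3) ^ n / 2"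
    unfolding sums_unique[OF tail, symmetric] real_norm_def .
  moreover have "\<bar>?d n\<bar> = (1/3) ^ n"
    using neq by (cases "a n"; cases "b n") simp_all
  ultimately show ?thesis unfolding split by linarith
qed

text \<open>A first disagreement at some \<open>k \<le> i\<close> would already separate the codes
  by \<open>(1/3) ^ k / 2\<close>, which is at least \<open>(1/3) ^ n / 2\<close>.\<close>

lemma ternary_close_imp_agree:
  assumes "\<bar>ternary a - ternary b\<bar> < (1/3) ^ n / 2" "i \<le> n"
  shows "a i = b i"
proof (rule ccontr)
  assume "a i \<noteq> b i"
  define k where "k = (LEAST k. a k \<noteq> b k)"
  have k: "a k \<noteq> b k" "\<And>j. j < k \<Longrightarrow> a j = b j"
    unfolding k_def using LeastI[of "\<lambda>k. a k \<noteq> b k", OF \<open>a i \<noteq> b i\<close>] not_less_Least[of _ "\<lambda>k. a k \<noteq> b k"]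
    by blast+
  have "k \<le> i" unfolding k_def using \<open>a i \<noteq> b i\<close> by (rule Least_le)
  then have "(1/3 :: real) ^ n \<le> (1/3) ^ k" using assms(2) by (intro power_decreasing) auto
  with ternary_first_difference[of k a b, OF k(2) k(1)] assms(1) show False by linarith
qed

text \<open>Finitely many basis sets on which \<open>g\<close> oscillates by less than
  \<open>e\<close> cover \<open>K\<close>. Two points whose codes agree at these finitely many
  indices either share one of the sets or both lie outside \<open>K\<close>, where \<open>g\<close>
  vanishes.\<close>

lemma compactly_supported_uniform_in_code:
  fixes g :: "'a::topological_space \<Rightarrow> real"
  assumes g: "compactly_supported g" and U: "\<And>j. open (U j)"
    and base: "\<And>W x. open W \<Longrightarrow> x \<in> W \<Longrightarrow> \<exists>j. x \<in> U j \<and> U j \<subseteq> W"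
    and e: "0 < e"
  obtains d where "0 < d"
    "\<And>x y. \<bar>ternary (\<lambda>j. x \<in> U j) - ternary (\<lambda>j. y \<in> U j)\<bar> < d \<Longrightarrow> \<bar>g x - g y\<bar> < (e :: real)"
proof -
  obtain K where cont: "continuous_on UNIV g" and K: "compact K" "\<And>x. x \<notin> K \<Longrightarrow> g x = 0"
    using g by (auto simp: compactly_supported_def)
  define J where "J = {j. \<forall>x\<in>U j. \<forall>y\<in>U j. \<bar>g x - g y\<bar> < e}"
  have "K \<subseteq> (\<Union>j\<in>J. U j)"
  proof
    fix x assume "x \<in> K"
    have "open {y. g y \<in> {g x - e/2<..<g x + e/2}}"
      using open_vimage[OF open_greaterThanLessThan cont] by (simp add: vimage_def)
    then obtain j where j: "x \<in> U j" "U j \<subseteq> {y. g y \<in> {g x - e/2<..<g x + e/2}}"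
      using base[of "{y. g y \<in> {g x - e/2<..<g x + e/2}}" x] e by auto
    have "j \<in> J" unfolding J_def
    proof (intro CollectI ballI)
      fix y z assume "y \<in> U j" "z \<in> U j"
      with j(2) have "g y \<in> {g x - e/2<..<g x + e/2}" "g z \<in> {g x - e/2<..<g x + e/2}" by auto
      then show "\<bar>g y - g z\<bar> < e" by auto
    qed
    with j(1) show "x \<in> (\<Union>j\<in>J. U j)" by auto
  qed
  with U obtain J' where J': "J' \<subseteq> J" "finite J'" "K \<subseteq> (\<Union>j\<in>J'. U j)"
    by (rule compactE_image[OF K(1)])
  obtain n where n: "J' \<subseteq> {..n}" using finite_nat_iff_bounded_le J'(2) by auto
  show ?thesis
  proof (rule that[of "(1/3) ^ n / 2"])
    fix x y assume "\<bar>ternary (\<lambda>j. x \<in> U j) - ternary (\<lambda>j. y \<in> U j)\<bar> < (1/3) ^ n / 2"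
    from ternary_close_imp_agree[OF this] have agree: "x \<in> U j \<longleftrightarrow> y \<in> U j" if "j \<in> J'" for j
      using n that by auto
    show "\<bar>g x - g y\<bar> < e"
    proof (cases "\<exists>j\<in>J'. x \<in> U j")
      case True
      then show ?thesis using agree J'(1) by (auto simp: J_def)
    next
      case False
      then have "x \<notin> K" "y \<notin> K" using agree J'(3) by auto
      then show ?thesis using K(2) e by simp
    qed
  qed simp
qed

text \<open>Weak convergence on the line tests against bounded continuous functions on all of it. So
  \<open>g\<close> is carried to the set of codes, extended to the closure by uniform continuity,
  and from there to the line by Tietze with the bound of \<open>g\<close>.\<close>

lemma compactly_supported_factor_through_code:
  fixes g :: "'a::topological_space \<Rightarrow> real"
  assumes g: "compactly_supported g" and U: "\<And>j. open (U j)"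
    and base: "\<And>W x. open W \<Longrightarrow> x \<in> W \<Longrightarrow> \<exists>j. x \<in> U j \<and> U j \<subseteq> W"
  obtains h B where "continuous_on UNIV h" "\<And>t. \<bar>h t\<bar> \<le> (B :: real)"
    "\<And>x. h (ternary (\<lambda>j. x \<in> U j)) = g x"
proof -
  define s where "s x = ternary (\<lambda>j. x \<in> U j)" for x
  have uc: "\<exists>d>0. \<forall>x y. \<bar>s x - s y\<bar> < d \<longrightarrow> \<bar>g x - g y\<bar> < e" if e: "0 < e" for e
  proof -
    obtain d where "0 < d"
      "\<And>x y. \<bar>ternary (\<lambda>j. x \<in> U j) - ternary (\<lambda>j. y \<in> U j)\<bar> < d \<Longrightarrow> \<bar>g x - g y\<bar> < e"
      using compactly_supported_uniform_in_code[OF g U base e] by blast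
    then show ?thesis unfolding s_def by blast
  qed
  define h0 where "h0 t = g (SOME x. s x = t)" for t
  \<comment> \<open>Independence of the chosen preimage comes from \<open>uc\<close>: points with
    equal codes are closer in code than any \<open>d\<close>, so their values under \<open>g\<close>
    cannot differ.\<close>
  have h0: "h0 (s x) = g x" for x
  proof (rule ccontr)
    define y where "y = (SOME y. s y = s x)"
    have y: "s y = s x" unfolding y_def by (rule someI[of _ x]) simp
    assume "h0 (s x) \<noteq> g x"
    then have "0 < \<bar>g y - g x\<bar>" by (simp add: h0_def y_def)
    from uc[OF this] obtain d where "0 < d"
      and d: "\<forall>x' y'. \<bar>s x' - s y'\<bar> < d \<longrightarrow> \<bar>g x' - g y'\<bar> < \<bar>g y - g x\<bar>" by blast
    have "\<bar>s y - s x\<bar> < d" using y \<open>0 < d\<close> by simp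
    with d have "\<bar>g y - g x\<bar> < \<bar>g y - g x\<bar>" by blast
    then show False by simp
  qed
  have "uniformly_continuous_on (range s) h0"
    unfolding uniformly_continuous_on_def
  proof (intro allI impI)
    fix e :: real assume "0 < e"
    then obtain d where "0 < d" "\<forall>x y. \<bar>s x - s y\<bar> < d \<longrightarrow> \<bar>g x - g y\<bar> < e" using uc by blast
    then show "\<exists>d>0. \<forall>x\<in>range s. \<forall>x'\<in>range s. dist x' x < d \<longrightarrow> dist (h0 x') (h0 x) < e"
      by (intro exI[of _ d]) (auto simp: h0 dist_real_def)
  qed
  then obtain h1 where h1: "uniformly_continuous_on (closure (range s)) h1" "\<And>x. x \<in> range s \<Longrightarrow> h0 x = h1 x"
    by (rule uniformly_continuous_on_extension_on_closure) (rule that)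
  obtain B where B: "0 \<le> B" "\<And>x. \<bar>g x\<bar> \<le> B" using compactly_supported_bounded[OF g] by blast
  have cont: "continuous_on (closure (range s)) h1"
    by (rule uniformly_continuous_imp_continuous[OF h1(1)])
  have h1_s: "h1 (s x) = g x" for x
    using h1(2)[of "s x"] h0 by simp
  have "h1 ` closure (range s) \<subseteq> cball 0 B"
    by (rule image_closure_subset[OF cont]) (use B(2) in \<open>auto simp: h1_s\<close>)
  then have bound: "\<And>t. t \<in> closure (range s) \<Longrightarrow> norm (h1 t) \<le> B"
    by (auto simp: image_subset_iff)
  have closed: "closedin (top_of_set UNIV) (closure (range s))"
    by (simp flip: closed_closedin)
  obtain h where h: "continuous_on UNIV h" "\<And>t. t \<in> closure (range s) \<Longrightarrow> h t = h1 t"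
    "\<And>t. t \<in> UNIV \<Longrightarrow> norm (h t) \<le> B"
    by (rule Tietze[OF cont closed B(1) bound]) (assumption, rule that)
  have "s x \<in> closure (range s)" for x
    by (rule subsetD[OF closure_subset]) simp
  then have "h (s x) = g x" for x
    using h(2) h1_s by simp
  with h(1,3) show ?thesis
    by (intro that[of h B]) (simp_all add: s_def)
qed

text \<open>Pushed forward to the codes, the measures live on a bounded interval and are
  automatically tight, so a subsequence converges weakly to some \<open>L\<close>. Decoding
  \<open>L\<close> gives \<nu>; the mass that \<open>L\<close> puts on limits of codes without a
  decoding is discarded, so \<nu> may have total mass below one.\<close>

lemma vague_sequential_compactness:
  fixes \<mu> :: "nat \<Rightarrow> 'a::polish_space measure"
  assumes lc: "locally_compact_space (euclidean :: 'a topology)"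
    and prob: "\<And>n. prob_space (\<mu> n)" and sets_\<mu>: "\<And>n. sets (\<mu> n) = sets borel"
  obtains r :: "nat \<Rightarrow> nat" and \<nu> :: "'a measure"
  where "strict_mono r" "sets \<nu> = sets borel" "finite_measure \<nu>"
    "\<And>g. compactly_supported g \<Longrightarrow> (\<lambda>n. \<integral>x. g x \<partial>\<mu> (r n)) \<longlonglongrightarrow> (\<integral>x. g x \<partial>\<nu>)"
proof -
  note sets_\<mu>[measurable_cong]
  obtain U :: "nat \<Rightarrow> 'a set" and b :: "nat \<Rightarrow> 'a \<Rightarrow> real"
    where U: "\<And>j. open (U j)" and b: "\<And>j. compactly_supported (b j)"
      and b_pos: "\<And>j x. b j x \<noteq> 0 \<longleftrightarrow> x \<in> U j"
      and base: "\<And>W x. open W \<Longrightarrow> x \<in> W \<Longrightarrow> \<exists>j. x \<in> U j \<and> U j \<subseteq> W"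
    using exists_bump_basis[OF lc] by metis
  have U_sets[measurable]: "U j \<in> sets borel" for j using U by (rule borel_open)
  define s where "s x = ternary (\<lambda>j. x \<in> U j)" for x
  have s_meas[measurable]: "s \<in> borel_measurable borel"
    unfolding s_def[abs_def] ternary_def by measurable
  have "\<forall>g. \<exists>h. compactly_supported g \<longrightarrow>
      continuous_on UNIV h \<and> (\<exists>B. \<forall>t. \<bar>h t\<bar> \<le> B) \<and> (\<forall>x. h (s x) = g x)"
  proof (intro allI)
    fix g :: "'a \<Rightarrow> real"
    show "\<exists>h. compactly_supported g \<longrightarrow>
      continuous_on UNIV h \<and> (\<exists>B. \<forall>t. \<bar>h t\<bar> \<le> B) \<and> (\<forall>x. h (s x) = g x)"
    proof (cases "compactly_supported g")
      case True
      obtain h B where "continuous_on UNIV h" "\<And>t. \<bar>h t\<bar> \<le> (B :: real)" "\<And>x. h (ternary (\<lambda>j. x \<in> U j)) = g x"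
        by (rule compactly_supported_factor_through_code[OF True U base]) (assumption, assumption, rule that)
      then show ?thesis by (intro exI[of _ h]) (auto simp: s_def)
    qed simp
  qed
  then obtain E where E: "\<forall>g. compactly_supported g \<longrightarrow>
      continuous_on UNIV (E g) \<and> (\<exists>B. \<forall>t. \<bar>E g t\<bar> \<le> B) \<and> (\<forall>x. E g (s x) = g x)"
    by (rule choice[THEN exE]) (rule that)
  have E_cont: "continuous_on UNIV (E g)" if "compactly_supported g" for g
    using E that by simp
  have E_s: "E g (s x) = g x" if "compactly_supported g" for g x
    using E that by simp
  have E_bnd: "\<exists>B. \<forall>t. \<bar>E g t\<bar> \<le> B" if "compactly_supported g" for g
    using E that by simp
  have E_meas: "E g \<in> borel_measurable borel" if "compactly_supported g" for g
    using E_cont[OF that] by (rule borel_measurable_continuous_onI)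
  note [measurable] = E_meas[OF b]
  define K where "K = closure (range s)"
  have K_meas[measurable]: "K \<in> sets borel" unfolding K_def by simp

  \<comment> \<open>A limit of codes at which some test function \<open>g0\<close> survives can be
    decoded: the coded points eventually stay in the support of \<open>g0\<close>, and a subsequence
    converges to some \<open>l\<close>. The subsequence depends on \<open>g0\<close> only, so the
    same \<open>l\<close> serves every \<open>g\<close>.\<close>
  have point: "\<exists>x. \<forall>g. compactly_supported g \<longrightarrow> E g t = g x"
    if t: "t \<in> K" and g0: "compactly_supported g0" "E g0 t \<noteq> 0" for t g0
  proof -
    obtain y where y: "\<And>n. y n \<in> range s" "y \<longlonglongrightarrow> t"
      using t unfolding K_def closure_sequential by blast
    then have "\<forall>n. \<exists>x. y n = s x" by auto
    then obtain x where x: "\<And>n. y n = s (x n)" by (auto dest: choice)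
    have lim: "(\<lambda>n. g (x n)) \<longlonglongrightarrow> E g t" if "compactly_supported g" for g
    proof -
      have "(\<lambda>n. E g (y n)) \<longlonglongrightarrow> E g t"
        using continuous_on_tendsto_compose[OF E_cont[OF that] y(2)] by simp
      then show ?thesis by (simp add: x E_s[OF that])
    qed
    obtain L where L: "compact L" "\<And>x. x \<notin> L \<Longrightarrow> g0 x = 0"
      using g0(1) by (auto simp: compactly_supported_def)
    have "eventually (\<lambda>n. g0 (x n) \<noteq> 0) sequentially"
      using tendsto_imp_eventually_ne[OF lim[OF g0(1)] g0(2)] .
    then obtain N where N: "\<And>n. n \<ge> N \<Longrightarrow> x n \<in> L"
      using L(2) by (auto simp: eventually_sequentially)
    then have "\<forall>n. x (n + N) \<in> L" by simp
    then obtain l \<rho> where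
      l: "strict_mono (\<rho> :: nat \<Rightarrow> nat)" "((\<lambda>n. x (n + N)) \<circ> \<rho>) \<longlonglongrightarrow> l"
      by (rule seq_compactE[OF compact_imp_seq_compact[OF L(1)]]) (rule that)
    show ?thesis
    proof (intro exI[of _ l] allI impI)
      fix g :: "'a \<Rightarrow> real" assume g: "compactly_supported g"
      then have "(\<lambda>n. g (((\<lambda>n. x (n + N)) \<circ> \<rho>) n)) \<longlonglongrightarrow> g l"
        by (intro continuous_on_tendsto_compose[OF _ l(2)]) (auto simp: compactly_supported_def)
      moreover have "(\<lambda>n. g (((\<lambda>n. x (n + N)) \<circ> \<rho>) n)) \<longlonglongrightarrow> E g t"
        using LIMSEQ_subseq_LIMSEQ[OF LIMSEQ_ignore_initial_segment[OF lim[OF g], of N] l(1)]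
        by (simp add: o_def)
      ultimately show "E g t = g l" by (rule LIMSEQ_unique[rotated])
    qed
  qed
  \<comment> \<open>\<open>K - K'\<close> consists of the limits of codes of points that escape to infinity.\<close>
  define K' where "K' = {t\<in>K. \<exists>j. E (b j) t \<noteq> 0}"
  have K'_meas[measurable]: "K' \<in> sets borel" unfolding K'_def by measurable
  define q where "q t = (SOME x. \<forall>g. compactly_supported g \<longrightarrow> E g t = g x)" for t
  have q: "E g t = g (q t)" if "t \<in> K'" "compactly_supported g" for g t
  proof -
    have "\<exists>x. \<forall>g. compactly_supported g \<longrightarrow> E g t = g x"
      using that(1) point[OF _ b] unfolding K'_def by blast
    from someI_ex[OF this] show ?thesis using that(2) unfolding q_def by blast
  qed
  \<comment> \<open>Countably many bumps detect all test functions: a \<open>t\<close> where some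
    \<open>E g\<close> is non-zero decodes to a point, and some bump is non-zero there. Defining
    \<open>K'\<close> through bumps alone keeps it Borel.\<close>
  have K'_iff: "t \<in> K'" if t: "t \<in> K" "compactly_supported g" "E g t \<noteq> 0" for g t
  proof -
    obtain x where x: "\<And>g. compactly_supported g \<Longrightarrow> E g t = g x"
      using point[OF t] by blast
    obtain j where "x \<in> U j" using base[of UNIV x] by auto
    then have "E (b j) t \<noteq> 0" using x[OF b] b_pos by simp
    then show ?thesis using t(1) by (auto simp: K'_def)
  qed
  \<comment> \<open>Although \<open>q\<close> is defined by choice, \<open>b j\<close> is non-zero
    exactly on \<open>U j\<close>, so \<open>q t \<in> U j\<close> means
    \<open>E (b j) t \<noteq> 0\<close>. Preimages of open sets are thus countable unions of Borel
    sets.\<close>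
  have q_meas: "q \<in> restrict_space borel K' \<rightarrow>\<^sub>M borel"
  proof (rule borel_measurableI)
    fix W :: "'a set" assume W: "open W"
    have "q -` W \<inter> K' = (\<Union>j\<in>{j. U j \<subseteq> W}. {t\<in>K. E (b j) t \<noteq> 0})" (is "_ = ?R")
    proof (intro equalityI subsetI)
      fix t assume t: "t \<in> q -` W \<inter> K'"
      then obtain j where "q t \<in> U j" "U j \<subseteq> W" using base[OF W, of "q t"] by auto
      then show "t \<in> ?R"
        using t q[OF _ b, of t j] b_pos[of j "q t"] by (auto simp: K'_def)
    next
      fix t assume "t \<in> ?R"
      then obtain j where j: "U j \<subseteq> W" "t \<in> K" "E (b j) t \<noteq> 0" by auto
      then have "t \<in> K'" by (auto simp: K'_def)
      with j show "t \<in> q -` W \<inter> K'"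
        using q[OF _ b, of t j] b_pos[of j "q t"] by auto
    qed
    also have "\<dots> \<in> sets borel" by measurable
    finally have "q -` W \<inter> K' \<in> sets borel" .
    then show "q -` W \<inter> space (restrict_space borel K') \<in> sets (restrict_space borel K')"
      by (auto simp: space_restrict_space sets_restrict_space)
  qed

  define D where "D n = distr (\<mu> n) borel s" for n
  have D_real: "real_distribution (D n)" for n
  proof -
    interpret prob_space "\<mu> n" by (rule prob)
    show ?thesis unfolding D_def by (rule real_distribution_distr) measurable
  qed
  have "tight D"
    unfolding tight_def
  proof (intro conjI allI impI D_real)
    fix e :: real assume "0 < e"
    have "measure (D n) {-1<..2} = 1" for n
    proof -
      interpret prob_space "\<mu> n" by (rule prob)
      have "s x \<in> {-1<..2}" for x
        using ternary_bounds[of "\<lambda>j. x \<in> U j"] by (simp add: s_def)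
      then have "s -` {-1<..2} \<inter> space (\<mu> n) = space (\<mu> n)" by auto
      then show ?thesis by (simp add: D_def measure_distr prob_space)
    qed
    then show "\<exists>a b. a < b \<and> (\<forall>n. measure (D n) {a<..b} > 1 - e)"
      using \<open>0 < e\<close> by (intro exI[of _ "-1"] exI[of _ 2]) auto
  qed
  from tight_imp_convergent_subsubsequence[OF this strict_mono_id]
  obtain r L where r: "strict_mono (r :: nat \<Rightarrow> nat)" and L: "real_distribution L"
    and conv: "weak_conv_m (D \<circ> r) L"
    by auto
  interpret L: real_distribution L by (rule L)
  have weak: "(\<lambda>n. \<integral>t. h t \<partial>D (r n)) \<longlonglongrightarrow> (\<integral>t. h t \<partial>L)"
    if "continuous_on UNIV h" "\<And>t. \<bar>h t\<bar> \<le> B" for h :: "real \<Rightarrow> real" and B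
    using weak_conv_imp_integral_bdd_continuous_conv[of "D \<circ> r" L h B] that D_real L conv
    by (simp add: continuous_on_eq_continuous_at)
  have D_int: "(\<integral>t. h t \<partial>D n) = (\<integral>x. h (s x) \<partial>\<mu> n)" if "h \<in> borel_measurable borel" for h :: "real \<Rightarrow> real" and n
    unfolding D_def using that by (intro integral_distr) measurable
  \<comment> \<open>The distance to \<open>K\<close>, capped at \<open>1\<close> to be bounded,
    vanishes at every code. Its integrals under \<open>D n\<close> are zero, and weak convergence
    passes this on to \<open>L\<close>.\<close>
  have "AE t in L. t \<in> K"
  proof -
    let ?h = "\<lambda>t. min 1 (infdist t K)"
    have cont: "continuous_on UNIV ?h" by (intro continuous_intros)
    have bound: "\<bar>?h t\<bar> \<le> 1" for t using infdist_nonneg[of t K] by auto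
    have meas: "?h \<in> borel_measurable borel"
      using cont by (rule borel_measurable_continuous_onI)
    have "?h (s x) = 0" for x
    proof -
      have "s x \<in> K" unfolding K_def by (rule subsetD[OF closure_subset]) simp
      then show ?thesis by simp
    qed
    then have "(\<integral>t. ?h t \<partial>D n) = 0" for n
      by (subst D_int[OF meas]) simp
    with weak[OF cont bound] have "(\<integral>t. ?h t \<partial>L) = 0"
      by (simp add: LIMSEQ_const_iff)
    moreover have "integrable L ?h"
      using bound meas by (intro L.integrable_const_bound[where B=1]) (auto simp del: min_less_iff_conj)
    moreover have "AE t in L. 0 \<le> ?h t" using infdist_nonneg by auto
    ultimately have "AE t in L. ?h t = 0"
      using integral_nonneg_eq_0_iff_AE by blast
    then show ?thesis
    proof eventually_elim
      case (elim t)
      then have "infdist t K = 0" by (auto simp: min_def split: if_splits)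
      then show ?case
        using in_closed_iff_infdist_zero[of K t] by (auto simp: K_def)
    qed
  qed
  define \<nu> where "\<nu> = distr (restrict_space L K') borel q"
  have q_meas': "q \<in> restrict_space L K' \<rightarrow>\<^sub>M borel"
    using q_meas by (simp cong: measurable_cong_sets restrict_space_sets_cong)
  have K'L: "K' \<inter> space L \<in> sets L" by measurable
  show ?thesis
  proof (rule that[of r \<nu>])
    show "finite_measure \<nu>"
    proof -
      have "finite_measure (restrict_space L K')"
        using K'L by (intro finite_measure_restrict_space L.finite_measure_axioms)
          (simp add: Int_commute)
      then show ?thesis
        unfolding \<nu>_def using q_meas' by (rule finite_measure.finite_measure_distr)
    qed
    fix g :: "'a \<Rightarrow> real" assume g: "compactly_supported g"
    note g_meas[measurable] = compactly_supported_measurable[OF g]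
    obtain B where "\<bar>E g t\<bar> \<le> B" for t using E_bnd[OF g] by blast
    from weak[OF E_cont[OF g] this]
    have "(\<lambda>n. \<integral>x. g x \<partial>\<mu> (r n)) \<longlonglongrightarrow> (\<integral>t. E g t \<partial>L)" by (simp add: D_int[OF E_meas[OF g]] E_s[OF g])
    \<comment> \<open>On \<open>K'\<close> the extension factors through \<open>q\<close>; on the
      rest of \<open>K\<close> it vanishes by \<open>K'_iff\<close>. So discarding the undecodable
      part of \<open>L\<close> changes no integral of a test function.\<close>
    also have "(\<integral>t. E g t \<partial>L) = (\<integral>t. indicator K' t *\<^sub>R g (q t) \<partial>L)"
    proof (rule integral_cong_AE)
      show "(\<lambda>t. indicator K' t *\<^sub>R g (q t)) \<in> borel_measurable L"
        using measurable_compose[OF q_meas' g_meas] K'L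
        by (subst (asm) borel_measurable_restrict_space_iff) auto
      show "E g \<in> borel_measurable L" using E_meas[OF g] by measurable
      show "AE t in L. E g t = indicator K' t *\<^sub>R g (q t)"
        using \<open>AE t in L. t \<in> K\<close>
      proof eventually_elim
        case (elim t)
        then show ?case
          using q[OF _ g, of t] K'_iff[OF elim g] by (cases "t \<in> K'") auto
      qed
    qed
    also have "\<dots> = (\<integral>t. g (q t) \<partial>restrict_space L K')"
      using K'L by (subst integral_restrict_space) auto
    also have "\<dots> = (\<integral>x. g x \<partial>\<nu>)"
      unfolding \<nu>_def using q_meas' by (subst integral_distr) auto
    finally show "(\<lambda>n. \<integral>x. g x \<partial>\<mu> (r n)) \<longlonglongrightarrow> (\<integral>x. g x \<partial>\<nu>)" .
  qed (simp_all add: r \<nu>_def)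
qed

subsection \<open>Invariant probabilities of Feller kernels\<close>

text \<open>At each point of \<open>W\<close> the partial sums of the bumps with
  \<open>U j \<subseteq> W\<close> eventually become positive, and outside \<open>W\<close> they
  stay zero. Multiplying by \<open>n\<close> and capping at \<open>1\<close> drives them up to the
  indicator, while each involves finitely many bumps only.\<close>

lemma open_indicator_compactly_supported_approx:
  fixes W :: "'a::polish_space set"
  assumes lc: "locally_compact_space (euclidean :: 'a topology)" and W: "open W"
  obtains h :: "nat \<Rightarrow> 'a \<Rightarrow> real"
  where "\<And>n. compactly_supported (h n)" "\<And>n x. 0 \<le> h n x" "\<And>n x. h n x \<le> 1"
    "\<And>n m x. n \<le> m \<Longrightarrow> h n x \<le> h m x" "\<And>x. (\<lambda>n. h n x) \<longlonglongrightarrow> indicator W x"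
proof -
  obtain U :: "nat \<Rightarrow> 'a set" and b :: "nat \<Rightarrow> 'a \<Rightarrow> real"
    where b: "\<And>j. compactly_supported (b j)" "\<And>j x. 0 \<le> b j x" "\<And>j x. b j x \<noteq> 0 \<longleftrightarrow> x \<in> U j"
      and base: "\<And>W x. open W \<Longrightarrow> x \<in> W \<Longrightarrow> \<exists>j. x \<in> U j \<and> U j \<subseteq> W"
    using exists_bump_basis[OF lc] by metis
  define J where "J n = {j. j < n \<and> U j \<subseteq> W}" for n
  have J[simp]: "finite (J n)" for n by (simp add: J_def)
  define S where "S n x = (\<Sum>j\<in>J n. b j x)" for n x
  have S_nonneg: "0 \<le> S n x" for n x unfolding S_def using b(2) by (intro sum_nonneg) simp
  have S_mono: "S n x \<le> S m x" if "n \<le> m" for n m x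
    unfolding S_def using that b(2) by (intro sum_mono2) (auto simp: J_def)
  define h where "h n x = min 1 (real n * S n x)" for n x
  show ?thesis
  proof (rule that[of h])
    show "compactly_supported (h n)" for n
    proof -
      have "\<forall>j. \<exists>K. compact K \<and> (\<forall>x. x \<notin> K \<longrightarrow> b j x = 0)"
        using b(1) by (simp add: compactly_supported_def)
      then obtain K where K: "\<And>j. compact (K j)" "\<And>j x. x \<notin> K j \<Longrightarrow> b j x = 0"
        by metis
      have "compact (\<Union>j\<in>J n. K j)" using K(1) by (intro compact_UN) auto
      moreover have "h n x = 0" if "x \<notin> (\<Union>j\<in>J n. K j)" for x
      proof -
        have "S n x = 0" unfolding S_def using that K(2) by (intro sum.neutral) auto
        then show ?thesis by (simp add: h_def)
      qed
      moreover have "continuous_on UNIV (h n)"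
        unfolding h_def[abs_def] S_def using b(1)
        by (intro continuous_intros) (auto simp: compactly_supported_def)
      ultimately show ?thesis unfolding compactly_supported_def by blast
    qed
    show "0 \<le> h n x" "h n x \<le> 1" for n x using S_nonneg by (simp_all add: h_def)
    show "h n x \<le> h m x" if "n \<le> m" for n m x
    proof -
      have "real n * S n x \<le> real m * S m x"
        using that S_mono[OF that] S_nonneg by (intro mult_mono) auto
      then show ?thesis by (auto simp: h_def)
    qed
    show "(\<lambda>n. h n x) \<longlonglongrightarrow> indicator W x" for x
    proof (cases "x \<in> W")
      case True
      obtain j where j: "x \<in> U j" "U j \<subseteq> W" using base[OF W True] by blast
      then have bj: "0 < b j x" using b(2)[of j x] b(3)[of j x] by simp
      obtain N where N: "1 / b j x \<le> real N" using real_arch_simple by blast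
      have "h n x = 1" if n: "n \<ge> max N (Suc j)" for n
      proof -
        have "1 = (1 / b j x) * b j x" using bj by simp
        also have "\<dots> \<le> real n * b j x"
          using N n bj by (intro mult_right_mono) auto
        also have "b j x \<le> S n x"
          unfolding S_def using n j b(2) by (intro member_le_sum) (auto simp: J_def)
        finally show ?thesis using n by (simp add: h_def mult_left_mono)
      qed
      then have "eventually (\<lambda>n. h n x = 1) sequentially"
        by (rule eventually_sequentiallyI)
      then show ?thesis using True by (simp add: tendsto_eventually)
    next
      case False
      have "b j x = 0" if "j \<in> J n" for j n
        using that False b(3)[of j x] by (auto simp: J_def)
      then have "h n x = 0" for n by (simp add: h_def S_def)
      then show ?thesis using False by simp
    qed
  qed
qed

lemma (in finite_measure) integral_tendsto_bounded:
  fixes u :: "nat \<Rightarrow> 'a \<Rightarrow> real"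
  assumes u: "\<And>n. u n \<in> borel_measurable M" and v: "v \<in> borel_measurable M"
    and bound: "\<And>n x. \<bar>u n x\<bar> \<le> B" and lim: "\<And>x. (\<lambda>n. u n x) \<longlonglongrightarrow> v x"
  shows "(\<lambda>n. \<integral>x. u n x \<partial>M) \<longlonglongrightarrow> (\<integral>x. v x \<partial>M)"
proof (rule integral_dominated_convergence[where w="\<lambda>_. B"])
  show "AE x in M. (\<lambda>n. u n x) \<longlonglongrightarrow> v x" by (rule AE_I2) (rule lim)
  show "AE x in M. norm (u n x) \<le> B" for n by (rule AE_I2) (simp add: bound)
qed (use u v in simp_all)

text \<open>The Krylov-Bogoliubov construction along an orbit \<open>m\<close> of laws, with
  \<open>recur\<close>, a positive asymptotic frequency of visits to \<open>C\<close>, in place of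
  tightness.\<close>

lemma feller_invariant_prob_exists:
  fixes P :: "'a::polish_space \<Rightarrow> 'a measure" and m :: "nat \<Rightarrow> 'a measure" and \<epsilon> :: real
  assumes lc: "locally_compact_space (euclidean :: 'a topology)"
    and P: "P \<in> borel \<rightarrow>\<^sub>M prob_algebra borel" and feller: "feller P"
    and m: "\<And>k. m k \<in> space (prob_algebra borel)" and m_Suc: "\<And>k. m (Suc k) = m k \<bind> P"
    and C: "compact C" and \<epsilon>: "0 < \<epsilon>"
    and recur: "eventually (\<lambda>N. \<epsilon> * real N \<le> (\<Sum>k<N. measure (m k) C)) sequentially"
  shows "\<exists>\<pi>. invariant_prob P \<pi>"
proof -
  note [measurable] = measurable_prob_algebraD[OF P]
  have P_prob: "prob_space (P x)" and P_sets[measurable_cong]: "sets (P x) = sets borel" for x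
    using measurable_space[OF P, of x] by (simp_all add: space_prob_algebra)
  have m_prob: "prob_space (m k)" and m_sets: "sets (m k) = sets borel" for k
    using m[of k] by (simp_all add: space_prob_algebra)
  \<comment> \<open>The average of the laws \<open>m 0\<close> to \<open>m N\<close>, written as a
    mixture over a uniformly chosen index. It has \<open>N + 1\<close> terms.\<close>
  define a where "a N = measure_pmf (pmf_of_set {..N}) \<bind> m" for N
  have m_meas: "m \<in> measure_pmf (pmf_of_set {..N}) \<rightarrow>\<^sub>M prob_algebra borel" for N
    using m by (auto simp: measurable_def sets_measure_pmf_count_space space_measure_pmf)
  have a_in: "a N \<in> space (prob_algebra borel)" for N
    unfolding a_def
  proof -
    let ?M = "measure_pmf (pmf_of_set {..N})"
    have "?M \<in> space (prob_algebra ?M)"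
      by (simp add: space_prob_algebra prob_space_measure_pmf)
    from measurable_space[OF measurable_bind_prob_space[OF measurable_const[OF this] m_meas], of undefined "count_space UNIV"]
    show "?M \<bind> m \<in> space (prob_algebra borel)" by simp
  qed
  have a_prob: "prob_space (a N)" and a_sets[measurable_cong]: "sets (a N) = sets borel" for N
    using a_in[of N] by (simp_all add: space_prob_algebra)
  have a_int: "(\<integral>x. g x \<partial>a N) = (\<Sum>k\<le>N. \<integral>x. g x \<partial>m k) / real (Suc N)"
    if g: "g \<in> borel_measurable borel" "\<And>x. \<bar>g x\<bar> \<le> B" for g :: "'a \<Rightarrow> real" and B N
  proof -
    have "(\<integral>x. g x \<partial>a N) = (\<integral>k. \<integral>x. g x \<partial>m k \<partial>measure_pmf (pmf_of_set {..N}))"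
      unfolding a_def
    proof (rule integral_bind[where K=borel and B=B and B'=1])
      show "AE k in measure_pmf (pmf_of_set {..N}). emeasure (m k) (space (m k)) \<le> ennreal 1"
        using m_prob by (simp add: prob_space.emeasure_space_1)
    qed (use g measurable_prob_algebraD[OF m_meas] in \<open>auto intro: measure_pmf.finite_measure\<close>)
    then show ?thesis by (simp add: integral_pmf_of_set)
  qed
  have bounded_int: "integrable M g"
    if fin: "finite_measure M" and sets: "sets M = sets borel"
      and g: "g \<in> borel_measurable borel" "\<And>x. \<bar>g x\<bar> \<le> B"
    for g :: "'a \<Rightarrow> real" and B and M :: "'a measure"
  proof (rule finite_measure.integrable_const_bound[OF fin])
    show "AE x in M. norm (g x) \<le> B" using g(2) by simp
    show "g \<in> borel_measurable M" using g(1) unfolding measurable_cong_sets[OF sets refl] .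
  qed
  obtain r \<nu> where r: "strict_mono (r :: nat \<Rightarrow> nat)" and \<nu>_sets[measurable_cong]: "sets \<nu> = sets borel"
    and \<nu>_fin: "finite_measure \<nu>"
    and lim: "\<And>g. compactly_supported g \<Longrightarrow> (\<lambda>n. \<integral>x. g x \<partial>a (r n)) \<longlonglongrightarrow> (\<integral>x. g x \<partial>\<nu>)"
    by (rule vague_sequential_compactness[of a, OF lc a_prob a_sets]) (rule that)
  interpret \<nu>: finite_measure \<nu> by (rule \<nu>_fin)
  have space_\<nu>: "space \<nu> = UNIV" using sets_eq_imp_space_eq[OF \<nu>_sets] by simp
  \<comment> \<open>Compactly supported cutoffs increasing to one. They localise \<open>P g\<close>
    in \<open>P_le\<close>, and near the end one of them dominates half the indicator of
    \<open>C\<close>.\<close>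
  obtain e :: "nat \<Rightarrow> 'a \<Rightarrow> real"
    where e: "\<And>n. compactly_supported (e n)" "\<And>n x. 0 \<le> e n x" "\<And>n x. e n x \<le> 1"
      "\<And>n m x. n \<le> m \<Longrightarrow> e n x \<le> e m x" and e_lim': "\<And>x. (\<lambda>n. e n x) \<longlonglongrightarrow> indicator UNIV x"
    by (rule open_indicator_compactly_supported_approx[OF lc open_UNIV]) (rule that)
  have e_lim: "(\<lambda>n. e n x) \<longlonglongrightarrow> 1" for x using e_lim'[of x] by simp

  \<comment> \<open>By the Feller property the integrand on the left is continuous, but it need not
    be compactly supported, so it is first multiplied by \<open>e k\<close>. The limit along the
    averages is taken for fixed \<open>k\<close>, and only then does \<open>k\<close> tend to
    infinity.\<close>
  have P_le: "(\<integral>x. (\<integral>y. g y \<partial>P x) \<partial>\<nu>) \<le> (\<integral>x. g x \<partial>\<nu>)"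
    if g: "compactly_supported g" "\<And>x. 0 \<le> g x" "\<And>x. g x \<le> 1" for g
  proof -
    let ?Pg = "\<lambda>x. \<integral>y. g y \<partial>P x"
    note g_meas[measurable] = compactly_supported_measurable[OF g(1)]
    have g_abs: "\<bar>g x\<bar> \<le> 1" for x using g(2,3)[of x] by simp
    have Pg_cont: "continuous_on UNIV ?Pg"
    proof -
      have "bounded (range g)" using g_abs by (auto simp: bounded_iff)
      then show ?thesis using feller g(1) unfolding feller_def compactly_supported_def by blast
    qed
    have Pg_meas[measurable]: "?Pg \<in> borel_measurable borel"
      using Pg_cont by (rule borel_measurable_continuous_onI)
    have Pg_nonneg: "0 \<le> ?Pg x" for x using g(2) by simp
    have Pg_le: "?Pg x \<le> 1" for x
    proof -
      interpret prob_space "P x" by (rule P_prob)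
      show ?thesis
        using g(3) bounded_int[OF finite_measure_axioms P_sets g_meas g_abs]
        by (intro integral_le_const) auto
    qed
    have Pg_abs: "\<bar>?Pg x\<bar> \<le> 1" for x using Pg_nonneg[of x] Pg_le[of x] by simp
    \<comment> \<open>Integrating \<open>P g\<close> against \<open>m k\<close> shifts the index by
      one, so the two sums differ only in their end terms; the added one is at most
      \<open>1\<close>.\<close>
    have near: "(\<integral>x. ?Pg x \<partial>a N) \<le> (\<integral>x. g x \<partial>a N) + 1 / real (Suc N)" for N
    proof -
      have step: "(\<integral>x. ?Pg x \<partial>m k) = (\<integral>x. g x \<partial>m (Suc k))" for k
      proof -
        have "(\<integral>x. g x \<partial>(m k \<bind> P)) = (\<integral>x. ?Pg x \<partial>m k)"
        proof (rule integral_bind[where K=borel and B=1 and B'=1])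
          show "P \<in> m k \<rightarrow>\<^sub>M subprob_algebra borel"
            using measurable_prob_algebraD[OF P] by (simp add: measurable_cong_sets[OF m_sets refl])
          show "finite_measure (m k)" using m_prob by (simp add: prob_space_def)
        qed (use g_abs P_prob in \<open>auto simp: prob_space.emeasure_space_1\<close>)
        then show ?thesis by (simp add: m_Suc)
      qed
      have "(\<Sum>k\<le>N. \<integral>x. ?Pg x \<partial>m k) = (\<Sum>k\<le>N. \<integral>x. g x \<partial>m (Suc k))"
        by (simp only: step)
      also have "\<dots> \<le> (\<integral>x. g x \<partial>m 0) + (\<Sum>k\<le>N. \<integral>x. g x \<partial>m (Suc k))"
        using g(2) by simp
      also have "\<dots> = (\<Sum>k\<le>N. \<integral>x. g x \<partial>m k) + (\<integral>x. g x \<partial>m (Suc N))"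
        using sum.atMost_Suc_shift[of "\<lambda>k. \<integral>x. g x \<partial>m k" N] by simp
      also have "(\<integral>x. g x \<partial>m (Suc N)) \<le> 1"
      proof -
        interpret prob_space "m (Suc N)" by (rule m_prob)
        show ?thesis
          using g(3) bounded_int[OF finite_measure_axioms m_sets g_meas g_abs]
          by (intro integral_le_const) auto
      qed
      finally show ?thesis
        unfolding a_int[OF Pg_meas Pg_abs] a_int[OF g_meas g_abs] add_divide_distrib[symmetric]
        by (intro divide_right_mono) auto
    qed
    have "(\<integral>x. e k x * ?Pg x \<partial>\<nu>) \<le> (\<integral>x. g x \<partial>\<nu>)" for k
    proof -
      have cs: "compactly_supported (\<lambda>x. e k x * ?Pg x)"
        using e(1)[of k] Pg_cont unfolding compactly_supported_def
        by (auto intro!: continuous_on_mult)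
      have "(\<lambda>N. 1 / real (Suc N)) \<longlonglongrightarrow> 0"
        using LIMSEQ_inverse_real_of_nat by (simp add: inverse_eq_divide)
      from tendsto_add[OF lim[OF g(1)] LIMSEQ_subseq_LIMSEQ[OF this r]]
      have "(\<lambda>n. (\<integral>x. g x \<partial>a (r n)) + 1 / real (Suc (r n))) \<longlonglongrightarrow> (\<integral>x. g x \<partial>\<nu>)"
        by (simp add: o_def)
      moreover have "(\<integral>x. e k x * ?Pg x \<partial>a N) \<le> (\<integral>x. g x \<partial>a N) + 1 / real (Suc N)" for N
      proof -
        interpret prob_space "a N" by (rule a_prob)
        have le: "e k x * ?Pg x \<le> ?Pg x" for x
          using e(2,3)[of k x] Pg_nonneg[of x] by (simp add: mult_left_le_one_le)
        have "\<bar>e k x * ?Pg x\<bar> \<le> 1" for x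
          using le[of x] Pg_le[of x] e(2)[of k x] Pg_nonneg[of x] by (simp add: abs_mult)
        then have "(\<integral>x. e k x * ?Pg x \<partial>a N) \<le> (\<integral>x. ?Pg x \<partial>a N)"
          using bounded_int[OF finite_measure_axioms a_sets compactly_supported_measurable[OF cs]]
            bounded_int[OF finite_measure_axioms a_sets Pg_meas Pg_abs] le
          by (intro integral_mono) auto
        then show ?thesis using near[of N] by linarith
      qed
      ultimately show ?thesis
        by (intro LIMSEQ_le[OF lim[OF cs]]) auto
    qed
    moreover have "(\<lambda>k. \<integral>x. e k x * ?Pg x \<partial>\<nu>) \<longlonglongrightarrow> (\<integral>x. ?Pg x \<partial>\<nu>)"
    proof (rule \<nu>.integral_tendsto_bounded)
      show "(\<lambda>k. e k x * ?Pg x) \<longlonglongrightarrow> ?Pg x" for x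
        using tendsto_mult_right[OF e_lim] by simp
      show "\<bar>e k x * ?Pg x\<bar> \<le> 1" for k x
        using mult_le_one[OF e(3)[of k x] Pg_nonneg[of x] Pg_le[of x]] e(2)[of k x] Pg_nonneg[of x]
        by (simp add: abs_mult)
      show "(\<lambda>x. e k x * ?Pg x) \<in> borel_measurable \<nu>" for k
        using compactly_supported_measurable[OF e(1)] by measurable
      show "?Pg \<in> borel_measurable \<nu>" by measurable
    qed
    ultimately show ?thesis by (intro LIMSEQ_le_const2) auto
  qed

  have open_le: "(\<integral>\<^sup>+x. emeasure (P x) W \<partial>\<nu>) \<le> emeasure \<nu> W" if W: "open W" for W
  proof -
    obtain h :: "nat \<Rightarrow> 'a \<Rightarrow> real"
      where h: "\<And>n. compactly_supported (h n)" "\<And>n x. 0 \<le> h n x" "\<And>n x. h n x \<le> 1"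
        "\<And>n m x. n \<le> m \<Longrightarrow> h n x \<le> h m x" "\<And>x. (\<lambda>n. h n x) \<longlonglongrightarrow> indicator W x"
      by (rule open_indicator_compactly_supported_approx[OF lc W]) (rule that)
    note h_meas[measurable] = compactly_supported_measurable[OF h(1)]
    have W_meas[measurable]: "W \<in> sets borel" using W by simp
    have h_abs: "\<bar>h n x\<bar> \<le> 1" for n x using h(2,3)[of n x] by simp
    have P_lim: "(\<lambda>n. \<integral>y. h n y \<partial>P x) \<longlonglongrightarrow> measure (P x) W" for x
    proof -
      interpret prob_space "P x" by (rule P_prob)
      have "(\<lambda>n. \<integral>y. h n y \<partial>P x) \<longlonglongrightarrow> (\<integral>y. indicator W y \<partial>P x)"
        by (rule integral_tendsto_bounded[OF _ _ h_abs h(5)]) measurable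
      then show ?thesis using sets_eq_imp_space_eq[OF P_sets[of x]] by simp
    qed
    have int_abs: "\<bar>\<integral>y. h n y \<partial>P x\<bar> \<le> 1" for n x
    proof -
      interpret prob_space "P x" by (rule P_prob)
      have "(\<integral>y. h n y \<partial>P x) \<le> 1"
        using h(3) bounded_int[OF finite_measure_axioms P_sets h_meas[of n] h_abs]
        by (intro integral_le_const) simp_all
      moreover have "0 \<le> (\<integral>y. h n y \<partial>P x)" using h(2) by (intro integral_nonneg_AE) simp
      ultimately show ?thesis by simp
    qed
    have lim1: "(\<lambda>n. \<integral>x. (\<integral>y. h n y \<partial>P x) \<partial>\<nu>) \<longlonglongrightarrow> (\<integral>x. measure (P x) W \<partial>\<nu>)"
      by (rule \<nu>.integral_tendsto_bounded[OF _ _ int_abs P_lim]) measurable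
    have lim2: "(\<lambda>n. \<integral>x. h n x \<partial>\<nu>) \<longlonglongrightarrow> (\<integral>x. indicator W x \<partial>\<nu>)"
      by (rule \<nu>.integral_tendsto_bounded[OF _ _ h_abs h(5)]) measurable
    have "(\<integral>x. measure (P x) W \<partial>\<nu>) \<le> (\<integral>x. indicator W x \<partial>\<nu>)"
      by (rule LIMSEQ_le[OF lim1 lim2]) (intro exI[of _ 0] allI impI P_le h)
    then have le: "(\<integral>x. measure (P x) W \<partial>\<nu>) \<le> measure \<nu> W"
      by (simp add: space_\<nu>)
    have "(\<integral>\<^sup>+x. emeasure (P x) W \<partial>\<nu>) = (\<integral>\<^sup>+x. ennreal (measure (P x) W) \<partial>\<nu>)"
      using P_prob by (simp add: finite_measure.emeasure_eq_measure prob_space_def)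
    also have "\<dots> = ennreal (\<integral>x. measure (P x) W \<partial>\<nu>)"
      using P_prob by (intro nn_integral_eq_integral \<nu>.integrable_const_bound[where B=1])
        (auto simp: prob_space.prob_le_1)
    also have "\<dots> \<le> emeasure \<nu> W"
      using le by (simp add: \<nu>.emeasure_eq_measure)
    finally show ?thesis .
  qed

  define \<nu>' where "\<nu>' = \<nu> \<bind> P"
  have \<nu>_ne: "space \<nu> \<noteq> {}" by (simp add: space_\<nu>)
  have P\<nu>: "P \<in> \<nu> \<rightarrow>\<^sub>M subprob_algebra borel" by measurable
  have \<nu>'_sets: "sets \<nu>' = sets borel"
    unfolding \<nu>'_def by (rule sets_bind_measurable[OF P\<nu> \<nu>_ne])
  have \<nu>'_emeasure: "emeasure \<nu>' A = (\<integral>\<^sup>+x. emeasure (P x) A \<partial>\<nu>)" if "A \<in> sets borel" for A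
    unfolding \<nu>'_def by (rule emeasure_bind[OF \<nu>_ne P\<nu> that])
  have P_UNIV: "emeasure (P x) UNIV = 1" for x
    using prob_space.emeasure_space_1[OF P_prob[of x]] sets_eq_imp_space_eq[OF P_sets[of x]] by simp
  have \<nu>'_UNIV: "emeasure \<nu>' UNIV = emeasure \<nu> UNIV"
    by (simp add: \<nu>'_emeasure P_UNIV space_\<nu>)
  have \<nu>'_space: "space \<nu>' = UNIV" using sets_eq_imp_space_eq[OF \<nu>'_sets] by simp
  interpret \<nu>': finite_measure \<nu>'
    by standard (simp add: \<nu>'_space \<nu>'_UNIV \<nu>.emeasure_eq_measure)
  \<comment> \<open>Open sets are reached by monotone limits of test functions, and outer regularity
    of both finite measures carries the inequality on to Borel sets, as infima over open supersets
    preserve it.\<close>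
  have \<nu>'_le: "emeasure \<nu>' A \<le> emeasure \<nu> A" if A: "A \<in> sets borel" for A
  proof -
    have "emeasure \<nu>' A = (INF U \<in> {U. A \<subseteq> U \<and> open U}. emeasure \<nu>' U)"
      by (rule outer_regular[OF \<nu>'_sets _ A]) simp
    also have "\<dots> \<le> (INF U \<in> {U. A \<subseteq> U \<and> open U}. emeasure \<nu> U)"
      using open_le by (intro INF_mono) (auto simp: \<nu>'_emeasure)
    also have "\<dots> = emeasure \<nu> A"
      by (rule outer_regular[OF \<nu>_sets _ A, symmetric]) simp
    finally show ?thesis .
  qed
  \<comment> \<open>The inequality holds for \<open>A\<close> and for \<open>- A\<close>, and the
    totals agree, so neither can be strict.\<close>
  have inv: "(\<integral>\<^sup>+x. emeasure (P x) A \<partial>\<nu>) = emeasure \<nu> A" if A: "A \<in> sets borel" for A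
  proof -
    have "measure \<nu>' A \<le> measure \<nu> A" "measure \<nu>' (- A) \<le> measure \<nu> (- A)"
      using \<nu>'_le[of A] \<nu>'_le[of "- A"] A
      by (auto simp: \<nu>.emeasure_eq_measure \<nu>'.emeasure_eq_measure)
    moreover have "measure \<nu>' (- A) = measure \<nu>' UNIV - measure \<nu>' A"
      "measure \<nu> (- A) = measure \<nu> UNIV - measure \<nu> A"
      using \<nu>.finite_measure_compl[of A] \<nu>'.finite_measure_compl[of A] A
      by (auto simp: \<nu>_sets \<nu>'_sets space_\<nu> \<nu>'_space Compl_eq_Diff_UNIV)
    moreover have "measure \<nu>' UNIV = measure \<nu> UNIV"
      using \<nu>'_UNIV by (simp add: measure_def)
    ultimately have "measure \<nu>' A = measure \<nu> A" by linarith
    then show ?thesis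
      using \<nu>'_emeasure[OF A] by (simp add: \<nu>.emeasure_eq_measure \<nu>'.emeasure_eq_measure)
  qed

  \<comment> \<open>\<open>recur\<close> concerns the indicator of \<open>C\<close>, which vague
    convergence cannot test. Finitely many sets \<open>{x. 1/2 < e n x}\<close> cover
    \<open>C\<close>, and by monotonicity of \<open>e\<close> the largest index gives one test
    function whose double dominates that indicator.\<close>
  have "emeasure \<nu> UNIV \<noteq> 0"
  proof
    assume zero: "emeasure \<nu> UNIV = 0"
    have C_sets[measurable]: "C \<in> sets borel" using C by (simp add: compact_imp_closed)
    have "C \<subseteq> (\<Union>n\<in>UNIV. {x. 1/2 < e n x})"
    proof
      fix x
      have "eventually (\<lambda>n. 1/2 < e n x) sequentially"
        by (rule order_tendstoD(1)[OF e_lim]) simp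
      then show "x \<in> (\<Union>n\<in>UNIV. {x. 1/2 < e n x})"
        by (auto simp: eventually_sequentially)
    qed
    moreover have "open {x. 1/2 < e n x}" for n
      using e(1)[of n] by (intro open_Collect_less) (auto simp: compactly_supported_def)
    ultimately obtain I where I: "finite I" "C \<subseteq> (\<Union>n\<in>I. {x. 1/2 < e n x})"
      using compactE_image[OF C, of UNIV "\<lambda>n. {x. 1/2 < e n x}"] by auto
    define n where "n = Max (insert 0 I)"
    have C_le: "indicator C x \<le> 2 * e n x" for x
    proof (cases "x \<in> C")
      case True
      then obtain i where "i \<in> I" "1/2 < e i x" using I(2) by auto
      moreover have "e i x \<le> e n x" using I(1) \<open>i \<in> I\<close> by (intro e(4)) (simp add: n_def)
      ultimately show ?thesis using True by simp
    qed (use e(2) in simp)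
    \<comment> \<open>As \<open>a N\<close> averages \<open>N + 1\<close> laws, \<open>recur\<close>
      is applied at \<open>Suc N\<close>; this is why it is first strengthened to hold at all later
      indices.\<close>
    have "eventually (\<lambda>N. \<epsilon> / 2 \<le> (\<integral>x. e n x \<partial>a N)) sequentially"
      using eventually_all_ge_at_top[OF recur]
    proof eventually_elim
      case (elim N)
      have en_abs: "\<bar>e n x\<bar> \<le> 1" for x using e(2,3)[of n x] by simp
      note en_meas = compactly_supported_measurable[OF e(1)[of n]]
      have "\<epsilon> * real (Suc N) \<le> (\<Sum>k\<le>N. measure (m k) C)"
        using elim[rule_format, of "Suc N"] by (simp add: lessThan_Suc_atMost)
      also have "\<dots> \<le> (\<Sum>k\<le>N. 2 * (\<integral>x. e n x \<partial>m k))"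
      proof (rule sum_mono)
        fix k
        interpret prob_space "m k" by (rule m_prob)
        have [measurable_cong]: "sets (m k) = sets borel" by (rule m_sets)
        have "measure (m k) C = (\<integral>x. indicator C x \<partial>m k)"
          using sets_eq_imp_space_eq[OF m_sets[of k]] by simp
        also have "\<dots> \<le> (\<integral>x. 2 * e n x \<partial>m k)"
          using C_le bounded_int[OF finite_measure_axioms m_sets en_meas en_abs]
          by (intro integral_mono) (auto intro!: integrable_const_bound[where B=1])
        finally show "measure (m k) C \<le> 2 * (\<integral>x. e n x \<partial>m k)" by simp
      qed
      also have "\<dots> = 2 * (real (Suc N) * (\<integral>x. e n x \<partial>a N))"
        by (simp add: a_int[OF en_meas en_abs] flip: sum_distrib_left)
      finally have "real (Suc N) * (\<epsilon> / 2) \<le> real (Suc N) * (\<integral>x. e n x \<partial>a N)"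
        by (simp add: mult.commute)
      then show ?case by (subst (asm) mult_le_cancel_left_pos) auto
    qed
    from eventually_subseq[OF r this]
    have "\<epsilon> / 2 \<le> (\<integral>x. e n x \<partial>\<nu>)"
      by (intro tendsto_lowerbound[OF lim[OF e(1)]]) auto
    moreover have "(\<integral>x. e n x \<partial>\<nu>) = 0"
    proof -
      have "AE x in \<nu>. e n x = 0"
        by (rule AE_I[of _ _ UNIV]) (auto simp: zero \<nu>_sets)
      then show ?thesis by (rule integral_eq_zero_AE)
    qed
    ultimately show False using \<epsilon> by simp
  qed
  then obtain c where c: "0 < c" "emeasure \<nu> UNIV = ennreal c"
    by (metis \<nu>.emeasure_eq_measure ennreal_eq_0_iff not_le)
  define \<pi> where "\<pi> = scale_measure (ennreal (1 / c)) \<nu>"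
  have "prob_space \<pi>"
    using c by (intro prob_spaceI) (simp add: \<pi>_def space_scale_measure space_\<nu> flip: ennreal_mult)
  moreover have "(\<integral>\<^sup>+x. emeasure (P x) A \<partial>\<pi>) = emeasure \<pi> A" if "A \<in> sets borel" for A
    using inv[OF that] that unfolding \<pi>_def
    by (subst nn_integral_scale_measure) auto
  ultimately show ?thesis
    by (intro exI[of _ \<pi>]) (auto simp: invariant_prob_def space_prob_algebra \<pi>_def \<nu>_sets)
qed

subsection \<open>Drift at stopping times\<close>

theorem mainTheorem2:
  fixes M :: "'w measure" and F :: "nat \<Rightarrow> 'w measure"
    and P :: "'a::polish_space \<Rightarrow> 'a measure"
    and \<phi> :: "nat \<Rightarrow> 'w \<Rightarrow> 'a" and Pr :: "'a measure \<Rightarrow> 'w measure"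
    and T :: "nat \<Rightarrow> 'w \<Rightarrow> nat"
    and V \<delta> f :: "'a \<Rightarrow> real" and C :: "'a set" and b :: real
  assumes "locally_compact_space (euclidean :: 'a topology)"
    and "markov_chain M F P \<phi> Pr"
    and "feller P"
    and "\<And>z. stopping_time F (T z)"
    and "\<And>\<omega>. \<omega> \<in> space M \<Longrightarrow> T 0 \<omega> = 0"
    and "\<And>z \<omega>. \<omega> \<in> space M \<Longrightarrow> T z \<omega> < T (Suc z) \<omega>"
    and "V \<in> borel_measurable borel" and "\<And>x. V x > 0"
    and "\<delta> \<in> borel_measurable borel" and "\<And>x. \<delta> x \<ge> 1"
    and "f \<in> borel_measurable borel" and "\<And>x. f x \<ge> 1"
    and "compact C"
    and "\<And>x z. AE \<omega> in Pr (return borel x).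
      enn2ereal (nn_cond_exp (Pr (return borel x)) (filtration.pre_sigma (space M) F (T z))
          (\<lambda>\<omega>'. ennreal (V (\<phi> (T (Suc z) \<omega>') \<omega>'))) \<omega>)
        \<le> ereal (V (\<phi> (T z \<omega>) \<omega>) - \<delta> (\<phi> (T z \<omega>) \<omega>) + b * indicator C (\<phi> (T z \<omega>) \<omega>))"
    and "\<And>x z. AE \<omega> in Pr (return borel x).
      nn_cond_exp (Pr (return borel x)) (filtration.pre_sigma (space M) F (T z))
          (\<lambda>\<omega>'. \<Sum>k = T z \<omega>'..<T (Suc z) \<omega>'. ennreal (f (\<phi> k \<omega>'))) \<omega>
        \<le> ennreal (\<delta> (\<phi> (T z \<omega>) \<omega>))"
  shows "(\<exists>\<pi>. invariant_prob P \<pi>) \<and>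
    (\<exists>c :: real. \<forall>\<pi>. invariant_prob P \<pi> \<longrightarrow>
      (\<forall>t. (\<integral>\<^sup>+\<omega>. ennreal (f (\<phi> t \<omega>)) \<partial>Pr \<pi>) = (\<integral>\<^sup>+x. ennreal (f x) \<partial>\<pi>)) \<and>
      (\<integral>\<^sup>+x. ennreal (f x) \<partial>\<pi>) \<le> ennreal c)"
proof -
  interpret markov_chain M F P \<phi> Pr by fact
  \<comment> \<open>\<open>B\<close> becomes the constant \<open>c\<close> of the
    conclusion.\<close>
  define B where "B = max b 0"
  have B: "0 \<le> B" by (simp add: B_def)
  have C_sets[measurable]: "C \<in> sets borel"
    using \<open>compact C\<close> by (simp add: compact_imp_closed)
  note [measurable] = assms(7,9,11)
  have f_ge: "1 \<le> f x" for x by fact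
  let ?K = "kernel_power P"
  have K: "?K k x \<in> space (prob_algebra borel)" for k x
    using measurable_space[OF measurable_kernel_power[OF kernel], of x k] by simp
  have K_prob: "prob_space (?K k x)" and K_sets: "sets (?K k x) = sets borel" for k x
    using K[of k x] by (simp_all add: space_prob_algebra)
  \<comment> \<open>The stopping times enter only here. Existence and the bound on the integral of
    \<open>f\<close> both rest on this estimate for the kernels.\<close>
  have sum_bound: "(\<Sum>k<N. \<integral>\<^sup>+y. ennreal (f y) \<partial>?K k x)
      \<le> ennreal (V x + B * (\<Sum>k<N. measure (?K k x) C))" for x N
  proof -
    have ret: "return borel x \<in> space (prob_algebra borel)"
      by (simp add: space_prob_algebra prob_space_return)
    note [measurable] = measurable_X_Pr[OF ret]
    have law: "(\<integral>\<^sup>+\<omega>. g (\<phi> k \<omega>) \<partial>Pr (return borel x)) = (\<integral>\<^sup>+y. g y \<partial>?K k x)"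
      if [measurable]: "g \<in> borel_measurable borel" for g :: "'a \<Rightarrow> ennreal" and k
      unfolding law_return[symmetric] by (subst nn_integral_distr) auto
    have law_f: "(\<integral>\<^sup>+\<omega>. ennreal (f (\<phi> k \<omega>)) \<partial>Pr (return borel x)) = (\<integral>\<^sup>+y. ennreal (f y) \<partial>?K k x)" for k
      by (rule law) measurable
    have vis: "(\<integral>\<^sup>+y. indicator C y \<partial>?K k x) = ennreal (measure (?K k x) C)" for k
    proof -
      interpret prob_space "?K k x" by (rule K_prob)
      show ?thesis by (simp add: K_sets emeasure_eq_measure)
    qed
    have "(\<Sum>k<N. \<integral>\<^sup>+\<omega>. ennreal (f (\<phi> k \<omega>)) \<partial>Pr (return borel x))
      \<le> (\<integral>\<^sup>+y. ennreal (V y) \<partial>return borel x)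
        + ennreal (max b 0) * (\<Sum>k<N. \<integral>\<^sup>+\<omega>. indicator C (\<phi> k \<omega>) \<partial>Pr (return borel x))"
      by (rule stopped_sum_bound[where T=T and \<delta>=\<delta>, OF assms(4-9) _ assms(11) C_sets ret assms(14,15)])
        (auto intro: order_trans[OF zero_le_one assms(10)])
    also have "(\<Sum>k<N. \<integral>\<^sup>+\<omega>. indicator C (\<phi> k \<omega>) \<partial>Pr (return borel x))
        = ennreal (\<Sum>k<N. measure (?K k x) C)"
      by (simp add: law vis)
    also have "(\<integral>\<^sup>+y. ennreal (V y) \<partial>return borel x) = ennreal (V x)"
      by (subst nn_integral_return) auto
    finally show ?thesis
      using B less_imp_le[OF assms(8)[of x]]
      by (simp add: law_f B_def[symmetric] ennreal_plus ennreal_mult sum_nonneg)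
  qed
  have "\<exists>\<pi>. invariant_prob P \<pi>"
  proof -
    fix x :: 'a
    show ?thesis
    \<comment> \<open>With \<open>s\<close> the expected number of visits to \<open>C\<close> before
      \<open>N\<close>, \<open>f \<ge> 1\<close> gives \<open>N \<le> V x + B * s\<close>. Once
      \<open>2 * V x \<le> N\<close>, this yields \<open>N / 2 \<le> B * s\<close>; dividing by
      \<open>B + 1\<close> instead of \<open>B\<close> avoids a zero denominator.\<close>
    proof (rule feller_invariant_prob_exists[where P=P and m="\<lambda>k. ?K k x" and C=C and \<epsilon>="1 / (2 * (B + 1))"])
      obtain N0 :: nat where N0: "2 * V x \<le> real N0" using real_arch_simple by blast
      show "\<forall>\<^sub>F N in sequentially. 1 / (2 * (B + 1)) * real N \<le> (\<Sum>k<N. measure (?K k x) C)"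
      proof (rule eventually_sequentiallyI[of N0])
        fix N assume N: "N0 \<le> N"
        let ?s = "\<Sum>k<N. measure (?K k x) C"
        have s: "0 \<le> ?s" by (intro sum_nonneg) simp
        have "1 \<le> (\<integral>\<^sup>+y. ennreal (f y) \<partial>?K k x)" for k
        proof -
          interpret prob_space "?K k x" by (rule K_prob)
          have "(\<integral>\<^sup>+y. 1 \<partial>?K k x) \<le> (\<integral>\<^sup>+y. ennreal (f y) \<partial>?K k x)"
            using f_ge by (intro nn_integral_mono) simp
          then show ?thesis by (simp add: emeasure_space_1)
        qed
        then have "(\<Sum>k<N. 1) \<le> (\<Sum>k<N. \<integral>\<^sup>+y. ennreal (f y) \<partial>?K k x)"
          by (intro sum_mono)
        also note sum_bound
        finally have "ennreal (real N) \<le> ennreal (V x + B * ?s)"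
          by (simp add: ennreal_of_nat_eq_real_of_nat)
        then have "real N \<le> V x + B * ?s"
          using B s less_imp_le[OF assms(8)[of x]] by (subst (asm) ennreal_le_iff) auto
        moreover have "2 * V x \<le> real N" using N0 N by simp
        ultimately have "real N \<le> 2 * (B + 1) * ?s" using s by (simp add: algebra_simps)
        then show "1 / (2 * (B + 1)) * real N \<le> ?s"
          using B by (simp add: field_simps)
      qed
    qed (use assms(1,3,13) kernel K B in auto)
  qed
  moreover have "\<forall>\<pi>. invariant_prob P \<pi> \<longrightarrow>
      (\<forall>t. (\<integral>\<^sup>+\<omega>. ennreal (f (\<phi> t \<omega>)) \<partial>Pr \<pi>) = (\<integral>\<^sup>+x. ennreal (f x) \<partial>\<pi>)) \<and>
      (\<integral>\<^sup>+x. ennreal (f x) \<partial>\<pi>) \<le> ennreal B"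
  proof (intro allI impI conjI)
    fix \<pi> t assume \<pi>: "invariant_prob P \<pi>"
    then have "\<pi> \<in> space (prob_algebra borel)" by (simp add: invariant_prob_def)
    note [measurable] = measurable_X_Pr[OF this]
    have "(\<integral>\<^sup>+\<omega>. ennreal (f (\<phi> t \<omega>)) \<partial>Pr \<pi>) = (\<integral>\<^sup>+x. ennreal (f x) \<partial>distr (Pr \<pi>) borel (\<phi> t))"
      by (subst nn_integral_distr) auto
    then show "(\<integral>\<^sup>+\<omega>. ennreal (f (\<phi> t \<omega>)) \<partial>Pr \<pi>) = (\<integral>\<^sup>+x. ennreal (f x) \<partial>\<pi>)"
      by (simp add: law_invariant[OF \<pi>])
  next
    fix \<pi> assume \<pi>: "invariant_prob P \<pi>"
    show "(\<integral>\<^sup>+x. ennreal (f x) \<partial>\<pi>) \<le> ennreal B"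
    proof (rule invariant_prob_nn_integral_le[OF kernel \<pi> _ assms(7) B])
      fix x N
      have "(\<Sum>k<N. measure (?K k x) C) \<le> (\<Sum>k<N. 1)"
        using K_prob by (intro sum_mono) (rule prob_space.prob_le_1)
      then have "B * (\<Sum>k<N. measure (?K k x) C) \<le> B * real N"
        using B by (intro mult_left_mono) auto
      then have "ennreal (V x + B * (\<Sum>k<N. measure (?K k x) C)) \<le> ennreal (V x + B * real N)"
        by (intro ennreal_leI) simp
      also have "\<dots> = ennreal (V x) + ennreal B * of_nat N"
        using B less_imp_le[OF assms(8)[of x]]
        by (simp add: ennreal_plus ennreal_mult ennreal_of_nat_eq_real_of_nat)
      finally show "(\<Sum>k<N. \<integral>\<^sup>+y. ennreal (f y) \<partial>?K k x) \<le> ennreal (V x) + ennreal B * of_nat N"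
        by (rule order_trans[OF sum_bound])
    qed (auto intro: less_imp_le[OF assms(8)])
  qed
  ultimately show ?thesis by blast
qed

end
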